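(* There is an absolute constant $c>0$ such that for all sufficiently large integers $t$, \[ r(4,t) \;\geq\; c\,\frac{t^3}{\log^4 t}, \] i.e. $r(4,t)=\Omega\bigl(t^3/\log^4 t\bigr)$ as $t\to\infty$.
   Context: For integers $s,t\ge 2$, the Ramsey number $r(s,t)$ is the minimum $n$ such that every graph on $n$ vertices contains a clique of order $s$ or an independent set of order $t$. Logarithms are natural. *)

theory Defs
  imports "HOL-Analysis.Analysis"
begin

definition simple_graph_on :: "nat set \<Rightarrow> (nat \<Rightarrow> nat \<Rightarrow> bool) \<Rightarrow> bool" where
  "simple_graph_on V E \<longleftrightarrow> (\<forall>x\<in>V. \<forall>y\<in>V. E x y \<longleftrightarrow> E y x) \<and> (\<forall>x\<in>V. \<not> E x x)"

definition has_clique :: "nat set \<Rightarrow> (nat \<Rightarrow> nat \<Rightarrow> bool) \<Rightarrow> nat \<Rightarrow> bool" where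
  "has_clique V E s \<longleftrightarrow> (\<exists>K\<subseteq>V. card K = s \<and> (\<forall>x\<in>K. \<forall>y\<in>K. x \<noteq> y \<longrightarrow> E x y))"

definition has_indep :: "nat set \<Rightarrow> (nat \<Rightarrow> nat \<Rightarrow> bool) \<Rightarrow> nat \<Rightarrow> bool" where
  "has_indep V E t \<longleftrightarrow> (\<exists>I\<subseteq>V. card I = t \<and> (\<forall>x\<in>I. \<forall>y\<in>I. x \<noteq> y \<longrightarrow> \<not> E x y))"

definition ramsey_number :: "nat \<Rightarrow> nat \<Rightarrow> nat" where
  "ramsey_number s t = (LEAST n. \<forall>E. simple_graph_on {0..<n} E \<longrightarrow>
      has_clique {0..<n} E s \<or> has_indep {0..<n} E t)"

end

theory Submission
  imports Defs "HOL-Library.Ramsey" "HOL-Library.Z2" "HOL-Algebra.Algebraic_Closure_Type"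
begin

text \<open>
  The graph of Mattheus and Verstraete. The secant lines of a Hermitian curve over a field with
  \<open>q\<^sup>2\<close> elements, joined when they meet on the curve, form a union of cliques, one for each
  point. The curve contains no O'Nan configuration (four lines meeting pairwise in six distinct
  points of the curve), so every \<open>K\<^sub>4\<close> has three concurrent lines and disappears once every clique
  is replaced by a complete bipartite graph. For random bipartitions, every set \<open>Y\<close> of at least
  \<open>32 q\<^sup>2\<close> lines still spans at least about \<open>|Y|\<^sup>2 / (128 q)\<close> edges, so by the container method of
  Kleitman and Winston there are few independent sets of size \<open>t\<close> of order \<open>q (log q)\<^sup>2\<close>, and some
  class of a random colouring with about \<open>q / (log q)\<^sup>2\<close> colours contains none of them, although it
  has about \<open>q\<^sup>3 (log q)\<^sup>2\<close> vertices.

  Neither the spectrum of the graph nor the projective closure of the curve is needed: convexity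
  replaces the former, and the non-vertical secants of the affine curve suffice. Taking \<open>q = 2 ^ k\<close>
  makes all signs disappear.
\<close>

section \<open>Ramsey numbers and graphs\<close>

text \<open>\<open>LEAST\<close> says something about its value only once some \<open>n\<close>
  qualifies, and that is Ramsey's theorem \<open>ramsey2\<close>. If the least \<open>n\<close> were
  at most \<open>card V\<close>, an injection of \<open>{0..<n}\<close> into \<open>V\<close> would
  pull \<open>adj\<close> back to a counterexample on \<open>n\<close> vertices.\<close>

lemma ramsey_number_gt:
  fixes adj :: "'a \<Rightarrow> 'a \<Rightarrow> bool"
  assumes fin: "finite V"
    and sym: "\<And>x y. x \<in> V \<Longrightarrow> y \<in> V \<Longrightarrow> adj x y \<Longrightarrow> adj y x"
    and irrefl: "\<And>x. x \<in> V \<Longrightarrow> \<not> adj x x"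
    and no_clique: "\<And>C. C \<subseteq> V \<Longrightarrow> card C = s \<Longrightarrow> \<exists>x\<in>C. \<exists>y\<in>C. x \<noteq> y \<and> \<not> adj x y"
    and no_indep: "\<And>I. I \<subseteq> V \<Longrightarrow> card I = t \<Longrightarrow> \<exists>x\<in>I. \<exists>y\<in>I. x \<noteq> y \<and> adj x y"
  shows "ramsey_number s t > card V"
proof -
  define Q where "Q n \<longleftrightarrow> (\<forall>E. simple_graph_on {0..<n} E \<longrightarrow>
      has_clique {0..<n} E s \<or> has_indep {0..<n} E t)" for n :: nat
  obtain r where r: "\<forall>(V::nat set) E. finite V \<and> card V \<ge> r \<longrightarrow>
      (\<exists>R\<subseteq>V. card R = s \<and> clique R E \<or> card R = t \<and> indep R E)"
    using ramsey2[of s t] by blast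
  have "Q r"
    unfolding Q_def
  proof (intro allI impI)
    fix E assume E: "simple_graph_on {0..<r} E"
    define F where "F = {{x, y} | x y. x \<in> {0..<r} \<and> y \<in> {0..<r} \<and> E x y}"
    obtain R where R: "R \<subseteq> {0..<r}"
      and "card R = s \<and> clique R F \<or> card R = t \<and> indep R F"
      using r[rule_format, of "{0..<r}" F] by auto
    have F: "{x, y} \<in> F \<longleftrightarrow> E x y" if "x \<in> R" "y \<in> R" for x y
    proof
      assume "{x, y} \<in> F"
      then obtain u v where uv: "{x, y} = {u, v}" "u \<in> {0..<r}" "v \<in> {0..<r}" "E u v"
        unfolding F_def by blast
      then have "E v u" using E by (simp add: simple_graph_on_def)
      then show "E x y" using uv by (metis doubleton_eq_iff)
    next
      assume "E x y"
      then show "{x, y} \<in> F" using that R unfolding F_def by blast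
    qed
    from \<open>card R = s \<and> clique R F \<or> card R = t \<and> indep R F\<close>
    show "has_clique {0..<r} E s \<or> has_indep {0..<r} E t"
    proof (elim disjE conjE)
      assume *: "card R = s" "clique R F"
      have "E x y" if "x \<in> R" "y \<in> R" "x \<noteq> y" for x y
        using *(2) that F[OF that(1,2)] by (auto simp: clique_def)
      then show ?thesis using * R unfolding has_clique_def by blast
    next
      assume *: "card R = t" "indep R F"
      have "\<not> E x y" if "x \<in> R" "y \<in> R" "x \<noteq> y" for x y
        using *(2) that F[OF that(1,2)] by (auto simp: indep_def)
      then show ?thesis using * R unfolding has_indep_def by blast
    qed
  qed
  then have least: "Q (ramsey_number s t)"
    unfolding ramsey_number_def Q_def[symmetric] by (rule LeastI)
  show ?thesis
  proof (rule ccontr)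
    assume small: "\<not> ?thesis"
    define n where "n = ramsey_number s t"
    have "n \<le> card V"
      using small by (simp add: n_def)
    obtain f where f: "bij_betw f {0..<card V} V"
      using ex_bij_betw_nat_finite[OF fin] by blast
    have fV: "f i \<in> V" if "i < n" for i
      using bij_betwE[OF f] that \<open>n \<le> card V\<close> by auto
    have inj: "inj_on f {0..<n}"
      using f \<open>n \<le> card V\<close> by (auto simp: bij_betw_def intro: inj_on_subset)
    define E where "E i j = adj (f i) (f j)" for i j
    have "simple_graph_on {0..<n} E"
      using sym irrefl fV by (auto simp: simple_graph_on_def E_def)
    then consider "has_clique {0..<n} E s" | "has_indep {0..<n} E t"
      using least unfolding Q_def n_def by blast
    then show False
    proof cases
      case 1
      then obtain C where C: "C \<subseteq> {0..<n}" "card C = s" "\<forall>x\<in>C. \<forall>y\<in>C. x \<noteq> y \<longrightarrow> E x y"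
        unfolding has_clique_def by blast
      have "f ` C \<subseteq> V" "card (f ` C) = s"
        using C fV inj by (auto simp: card_image inj_on_subset)
      from no_clique[OF this] C(3) show False
        by (auto simp: E_def)
    next
      case 2
      then obtain I where I: "I \<subseteq> {0..<n}" "card I = t" "\<forall>x\<in>I. \<forall>y\<in>I. x \<noteq> y \<longrightarrow> \<not> E x y"
        unfolding has_indep_def by blast
      have "f ` I \<subseteq> V" "card (f ` I) = t"
        using I fV inj by (auto simp: card_image inj_on_subset)
      from no_indep[OF this] I(3) show False
        by (auto simp: E_def)
    qed
  qed
qed

section \<open>Counting independent sets\<close>

lemma sum_Pow_power_card:
  fixes x :: "'b :: comm_semiring_1"
  assumes "finite A"
  shows "(\<Sum>Y\<in>Pow A. x ^ card Y) = (1 + x) ^ card A"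
  using prod_add[OF assms, of "\<lambda>_. x" "\<lambda>_. 1"] by (simp add: add.commute)

definition indep_sets :: "('a \<Rightarrow> 'a \<Rightarrow> bool) \<Rightarrow> 'a set \<Rightarrow> 'a set set" where
  "indep_sets adj A = {I. I \<subseteq> A \<and> (\<forall>x\<in>I. \<forall>y\<in>I. \<not> adj x y)}"

text \<open>The independence polynomial of the graph induced on \<open>A\<close>.\<close>

definition indep_poly :: "('a \<Rightarrow> 'a \<Rightarrow> bool) \<Rightarrow> 'a set \<Rightarrow> real \<Rightarrow> real" where
  "indep_poly adj A x = (\<Sum>I\<in>indep_sets adj A. x ^ card I)"

lemma finite_indep_sets: "finite A \<Longrightarrow> finite (indep_sets adj A)"
  unfolding indep_sets_def by (rule finite_subset[of _ "Pow A"]) auto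

lemma indep_poly_le:
  assumes "finite A" "x \<ge> 0"
  shows "indep_poly adj A x \<le> (1 + x) ^ card A"
proof -
  have "indep_poly adj A x \<le> (\<Sum>I\<in>Pow A. x ^ card I)"
    unfolding indep_poly_def
    by (rule sum_mono2) (use assms in \<open>auto simp: indep_sets_def\<close>)
  then show ?thesis
    by (simp add: sum_Pow_power_card assms(1))
qed

text \<open>An independent set either avoids \<open>v\<close>, or is \<open>v\<close> together with
  an independent set of non-neighbours of \<open>v\<close>.\<close>

lemma indep_poly_delete:
  assumes fin: "finite A" and v: "v \<in> A" and x: "x \<ge> 0"
  shows "indep_poly adj A x \<le>
    indep_poly adj (A - {v}) x + x * indep_poly adj (A - {v} - {w\<in>A. adj v w}) x"
proof -
  let ?S = "indep_sets adj (A - {v})" and ?N = "indep_sets adj (A - {v} - {w\<in>A. adj v w})"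
  have "indep_sets adj A \<subseteq> ?S \<union> insert v ` ?N"
  proof
    fix I assume I: "I \<in> indep_sets adj A"
    show "I \<in> ?S \<union> insert v ` ?N"
    proof (cases "v \<in> I")
      case True
      then have "I = insert v (I - {v})" "I - {v} \<in> ?N"
        using I by (auto simp: indep_sets_def)
      then show ?thesis by blast
    qed (use I in \<open>auto simp: indep_sets_def\<close>)
  qed
  then have "indep_poly adj A x \<le> (\<Sum>I\<in>?S \<union> insert v ` ?N. x ^ card I)"
    unfolding indep_poly_def by (rule sum_mono2[rotated]) (use fin x in \<open>auto simp: finite_indep_sets\<close>)
  also have "\<dots> \<le> (\<Sum>I\<in>?S. x ^ card I) + (\<Sum>I\<in>insert v ` ?N. x ^ card I)"
    using sum.union_inter[of ?S "insert v ` ?N" "\<lambda>I. x ^ card I"]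
      sum_nonneg[of "?S \<inter> insert v ` ?N" "\<lambda>I. x ^ card I"] fin x
    by (simp add: finite_indep_sets)
  also have "(\<Sum>I\<in>insert v ` ?N. x ^ card I) = (\<Sum>I\<in>?N. x ^ card (insert v I))"
    by (rule sum.reindex_cong[of "insert v"]) (auto simp: indep_sets_def inj_on_def)
  also have "\<dots> = x * indep_poly adj (A - {v} - {w\<in>A. adj v w}) x"
    unfolding indep_poly_def sum_distrib_left
  proof (rule sum.cong)
    fix I assume "I \<in> ?N"
    then have "finite I" "v \<notin> I"
      using fin by (auto simp: indep_sets_def intro: finite_subset)
    then show "x ^ card (insert v I) = x * x ^ card I" by simp
  qed simp
  finally show ?thesis
    by (simp add: indep_poly_def)
qed

text \<open>Kleitman and Winston's algorithm in generating-function form: deleting a vertex of large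
  degree, and its neighbourhood whenever the vertex is put into the independent set, at most
  \<open>r\<close> vertices are put in before at most \<open>R\<close> candidates remain.\<close>

lemma indep_poly_container:
  fixes \<alpha> x :: real
  assumes fin: "finite V" and x: "x \<ge> 0" and \<alpha>: "0 \<le> \<alpha>" "\<alpha> \<le> 1"
    and deg: "\<And>Y. Y \<subseteq> V \<Longrightarrow> card Y > R \<Longrightarrow> \<exists>v\<in>Y. \<alpha> * card Y \<le> card {w\<in>Y. adj v w}"
    and irrefl: "\<And>v. v \<in> V \<Longrightarrow> \<not> adj v v"
    and A: "A \<subseteq> V" "(1 - \<alpha>) ^ r * card A \<le> R"
  shows "indep_poly adj A x \<le> (1 + x) ^ R * (1 + x * card A) ^ r"
  using A
proof (induction "card A" arbitrary: A r rule: less_induct)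
  case less
  have finA: "finite A" using fin less.prems(1) finite_subset by blast
  have one: "1 \<le> (1 + x * card A) ^ r" using x by simp
  show ?case
  proof (cases "card A \<le> R")
    case True
    have "indep_poly adj A x \<le> (1 + x) ^ card A"
      by (rule indep_poly_le) (use finA x in auto)
    also have "\<dots> \<le> (1 + x) ^ R"
      by (rule power_increasing) (use True x in auto)
    also have "\<dots> \<le> (1 + x) ^ R * (1 + x * card A) ^ r"
      using mult_left_mono[OF one, of "(1 + x) ^ R"] x by simp
    finally show ?thesis .
  next
    case False
    then obtain v where v: "v \<in> A" and dv: "\<alpha> * card A \<le> card {w\<in>A. adj v w}"
      using deg[OF less.prems(1)] by auto
    have "r \<noteq> 0"
      using less.prems(2) False by (cases r) auto
    then obtain r' where r': "r = Suc r'" by (cases r) auto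
    let ?B = "A - {v}" and ?C = "A - {v} - {w\<in>A. adj v w}"
    define a where "a = real (card A) - 1"
    have "card ?B = card A - 1" "card A > 0"
      using v finA by (auto simp: card_gt_0_iff)
    then have cB: "real (card ?B) = a" "card ?B < card A"
      by (auto simp: a_def)
    have a: "a \<ge> 0" using cB by linarith
    have cC: "card ?C \<le> card ?B"
      by (intro card_mono) (use finA in auto)
    have "?C \<subseteq> A - {w\<in>A. adj v w}" by auto
    then have "card ?C \<le> card (A - {w\<in>A. adj v w})"
      by (intro card_mono) (use finA in auto)
    also have "\<dots> = card A - card {w\<in>A. adj v w}"
      by (rule card_Diff_subset) (use finA in auto)
    finally have "real (card ?C) \<le> real (card A) - card {w\<in>A. adj v w}"
      using card_mono[of A "{w\<in>A. adj v w}"] finA by auto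
    also have "\<dots> \<le> (1 - \<alpha>) * card A" using dv by (simp add: algebra_simps)
    finally have small: "real (card ?C) \<le> (1 - \<alpha>) * card A" .
    \<comment> \<open>Leaving \<open>v\<close> out costs one candidate and keeps \<open>r\<close>.
      Putting \<open>v\<close> in removes at least a fraction \<open>\<alpha>\<close> of the
      candidates, which pays for lowering \<open>r\<close> by one.\<close>
    have IB: "indep_poly adj ?B x \<le> (1 + x) ^ R * (1 + x * card ?B) ^ r"
    proof (rule less.hyps)
      have "(1 - \<alpha>) ^ r * card ?B \<le> (1 - \<alpha>) ^ r * card A"
        by (intro mult_left_mono) (use \<alpha> cB in auto)
      then show "(1 - \<alpha>) ^ r * card ?B \<le> R" using less.prems(2) by linarith
    qed (use cB less.prems in auto)
    have IC: "indep_poly adj ?C x \<le> (1 + x) ^ R * (1 + x * card ?C) ^ r'"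
    proof (rule less.hyps)
      have "(1 - \<alpha>) ^ r' * card ?C \<le> (1 - \<alpha>) ^ r' * ((1 - \<alpha>) * card A)"
        by (intro mult_left_mono) (use \<alpha> small in auto)
      also have "\<dots> \<le> R" using less.prems(2) by (simp add: r' mult_ac)
      finally show "(1 - \<alpha>) ^ r' * card ?C \<le> R" .
    qed (use cB cC less.prems in auto)
    have "(1 + x * card ?C) ^ r' \<le> (1 + x * a) ^ r'"
      by (intro power_mono add_left_mono mult_left_mono) (use x cC cB in auto)
    then have IC': "indep_poly adj ?C x \<le> (1 + x) ^ R * (1 + x * a) ^ r'"
      by (intro order_trans[OF IC] mult_left_mono) (use x in auto)
    have "indep_poly adj A x \<le> indep_poly adj ?B x + x * indep_poly adj ?C x"
      by (rule indep_poly_delete) (use finA v x in auto)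
    also have "\<dots> \<le> (1 + x) ^ R * (1 + x * a) ^ r + x * ((1 + x) ^ R * (1 + x * a) ^ r')"
      using IB IC' x cB(1) by (intro add_mono mult_left_mono) auto
    \<comment> \<open>As \<open>r = Suc r'\<close>, the factor taken out is
      \<open>(1 + x * a) + x = 1 + x * card A\<close>: the one vertex missing from
      \<open>A - {v}\<close> absorbs the second summand.\<close>
    also have "\<dots> = (1 + x) ^ R * ((1 + x * card A) * (1 + x * a) ^ r')"
      by (simp add: r' a_def algebra_simps)
    also have "\<dots> \<le> (1 + x) ^ R * ((1 + x * card A) * (1 + x * card A) ^ r')"
      by (intro mult_left_mono power_mono add_left_mono) (use x a in \<open>auto simp: a_def\<close>)
    finally show ?thesis by (simp add: r')
  qed
qed

lemma card_indep_sets_le: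
  fixes x :: real
  assumes "finite A" "x > 0"
  shows "card {I \<in> indep_sets adj A. card I = t} * x ^ t \<le> indep_poly adj A x"
proof -
  have "card {I \<in> indep_sets adj A. card I = t} * x ^ t = (\<Sum>I\<in>{I \<in> indep_sets adj A. card I = t}. x ^ card I)"
    by simp
  also have "\<dots> \<le> indep_poly adj A x"
    unfolding indep_poly_def
    by (rule sum_mono2) (use assms in \<open>auto simp: finite_indep_sets\<close>)
  finally show ?thesis .
qed

section \<open>Random colourings that avoid a family of sets\<close>

text \<open>A uniformly random map to \<open>k\<close> colours is constant on a given set of size \<open>t\<close> with
  probability \<open>k ^ (1 - t)\<close>.\<close>

lemma ex_large_subset_avoiding:
  assumes fin: "finite V" and T: "\<And>I. I \<in> T \<Longrightarrow> I \<subseteq> V \<and> card I = t"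
    and "k > 0" and k: "card T * k < k ^ t"
  shows "\<exists>W\<subseteq>V. card V \<le> card W * k \<and> (\<forall>I\<in>T. \<not> I \<subseteq> W)"
proof -
  define F where "F = PiE V (\<lambda>_. {..<k})"
  define M where "M I c = PiE V (\<lambda>v. if v \<in> I then {c} else {..<k})" for I c
  have cF: "card F = k ^ card V"
    by (simp add: F_def card_PiE fin)
  have finF: "finite F" unfolding F_def by (rule finite_PiE) (use fin in auto)
  have finT: "finite T" using T fin by (intro finite_subset[of T "Pow V"]) auto
  have cM: "card (M I c) = k ^ (card V - t)" if "I \<in> T" for I c
  proof -
    have "card (M I c) = (\<Prod>v\<in>V. if v \<in> I then 1 else k)"
      unfolding M_def using fin by (simp add: card_PiE if_distrib cong: if_cong)
    also have "\<dots> = (\<Prod>v\<in>V - I. k)"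
      using fin by (intro prod.mono_neutral_cong_right) auto
    also have "\<dots> = k ^ (card V - t)"
      using T[OF that] fin by (metis card_Diff_subset finite_subset prod_constant)
    finally show ?thesis .
  qed
  \<comment> \<open>First moment: at most \<open>card T * k * k ^ (card V - t)\<close> colourings
    make a member of \<open>T\<close> monochromatic, fewer than the total
    \<open>k ^ card V\<close>.\<close>
  have ex: "\<exists>f\<in>F. \<forall>I\<in>T. \<forall>c<k. f \<notin> M I c"
  proof (rule ccontr)
    assume "\<not> ?thesis"
    then have sub: "F \<subseteq> (\<Union>(I,c)\<in>T \<times> {..<k}. M I c)" by auto
    have "t \<le> card V" if "T \<noteq> {}"
      using that T fin by (metis card_mono ex_in_conv)
    have "M I c \<subseteq> F" if "c < k" for I c
      unfolding M_def F_def using that by (intro PiE_mono) auto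
    then have "finite (\<Union>(I,c)\<in>T \<times> {..<k}. M I c)"
      using finF by (intro finite_subset[OF _ finF]) auto
    then have "card F \<le> card (\<Union>(I,c)\<in>T \<times> {..<k}. M I c)"
      using sub by (rule card_mono)
    also have "\<dots> \<le> (\<Sum>(I,c)\<in>T \<times> {..<k}. card (M I c))"
      using card_UN_le[of "T \<times> {..<k}" "\<lambda>(I,c). M I c"] finT by (simp add: case_prod_unfold)
    also have "\<dots> = (\<Sum>(I,c)\<in>T \<times> {..<k}. k ^ (card V - t))"
      by (rule sum.cong) (auto simp: cM)
    also have "\<dots> = card T * k * k ^ (card V - t)"
      by (simp add: case_prod_unfold card_cartesian_product)
    finally have le: "k ^ card V \<le> card T * k * k ^ (card V - t)" by (simp add: cF)
    show False
    proof (cases "T = {}")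
      case True
      then show False using le \<open>k > 0\<close> by simp
    next
      case False
      then have "t \<le> card V" by fact
      then have "k ^ card V = k ^ t * k ^ (card V - t)" by (simp flip: power_add)
      also have "\<dots> > card T * k * k ^ (card V - t)"
        using k \<open>k > 0\<close> by simp
      finally show False using le by simp
    qed
  qed
  then obtain f where f: "f \<in> F" "\<And>I c. I \<in> T \<Longrightarrow> c < k \<Longrightarrow> f \<notin> M I c" by blast
  define W where "W c = {v\<in>V. f v = c}" for c
  have avoid: "\<not> I \<subseteq> W c" if "I \<in> T" "c < k" for I c
  proof
    assume "I \<subseteq> W c"
    then have "f \<in> M I c"
      using f(1) by (auto simp: M_def F_def W_def PiE_iff)
    with f(2) that show False by blast
  qed
  have "V = (\<Union>c<k. W c)"
    using f(1) by (auto simp: W_def F_def PiE_iff)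
  then have "card V \<le> (\<Sum>c<k. card (W c))"
    by (metis card_UN_le finite_lessThan)
  \<comment> \<open>Pigeonhole: some colour class has at least the average size.\<close>
  have "\<exists>c<k. card V \<le> card (W c) * k"
  proof (rule ccontr)
    assume "\<not> ?thesis"
    then have "card (W c) * k < card V" if "c < k" for c using that by force
    then have "(\<Sum>c<k. card (W c) * k) < (\<Sum>c<k. card V)"
      using \<open>k > 0\<close> by (intro sum_strict_mono) auto
    then have "(\<Sum>c<k. card (W c)) * k < k * card V" by (simp add: sum_distrib_right)
    with \<open>card V \<le> _\<close> show False by (simp add: mult.commute)
  qed
  moreover have "W c \<subseteq> V" for c by (auto simp: W_def)
  ultimately show ?thesis using avoid by meson
qed

section \<open>Random bipartitions of pencils of lines\<close>

text \<open>An exponential moment bound. With weight \<open>(1/16) ^ card T\<close>, every counted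
  set weighs at least \<open>2 powr (- card D / 4)\<close>, while all subsets of \<open>D\<close>
  together weigh \<open>(17/16) ^ card D\<close>. As \<open>(17/16) ^ 8 \<le> 2\<close>, the
  exponent becomes \<open>3/8 * card D\<close>, and \<open>8 \<le> card D\<close> leaves room for
  the \<open>- 1\<close>.\<close>

lemma card_small_subsets:
  assumes fin: "finite D" and d: "8 \<le> card D"
  shows "real (card {T. T \<subseteq> D \<and> 16 * card T < card D}) \<le> 2 powr (card D / 2 - 1)"
proof -
  let ?d = "real (card D)" and ?T = "{T. T \<subseteq> D \<and> 16 * card T < card D}"
  have "1 \<le> 2 powr (?d / 4) * (1 / 16) ^ card T" if "T \<in> ?T" for T
  proof -
    have "(16::real) ^ card T = 2 powr (4 * card T)"
      by (simp add: powr_realpow[symmetric] powr_powr[symmetric])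
    also have "\<dots> \<le> 2 powr (?d / 4)"
      using that by (intro powr_mono) auto
    finally show ?thesis by (simp add: field_simps)
  qed
  then have "(\<Sum>T\<in>?T. 1) \<le> (\<Sum>T\<in>?T. 2 powr (?d / 4) * (1 / 16) ^ card T)"
    by (rule sum_mono)
  also have "\<dots> \<le> (\<Sum>T\<in>Pow D. 2 powr (?d / 4) * (1 / 16) ^ card T)"
    by (rule sum_mono2) (use fin in auto)
  also have "\<dots> = 2 powr (?d / 4) * (17 / 16) ^ card D"
    by (simp add: sum_distrib_left[symmetric] sum_Pow_power_card[OF fin])
  also have "(17 / 16) ^ card D = ((17 / 16) powr real 8) powr (?d / 8)"
    unfolding powr_powr by (simp add: powr_realpow)
  also have "(17 / 16) powr real 8 = (17 / 16 :: real) ^ 8"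
    by (rule powr_realpow) simp
  also have "((17 / 16) ^ 8) powr (?d / 8) \<le> 2 powr (?d / 8)"
    by (intro powr_mono2) (auto simp: power_divide)
  also have "2 powr (?d / 4) * 2 powr (?d / 8) = 2 powr (?d / 4 + ?d / 8)"
    by (rule powr_add[symmetric])
  also have "\<dots> \<le> 2 powr (?d / 2 - 1)"
    using d by (intro powr_mono) auto
  finally show ?thesis by simp
qed

definition unbalanced :: "'a set \<Rightarrow> 'a set \<Rightarrow> bool" where
  "unbalanced D S \<longleftrightarrow> 16 * card (S \<inter> D) < card D \<or> 16 * card (D - S) < card D"

text \<open>\<open>S\<close> is recovered from \<open>S - D\<close> together with
  \<open>S \<inter> D\<close> or \<open>D - S\<close>, whichever is small. The \<open>- 1\<close> in
  \<open>card_small_subsets\<close> pays for having two cases.\<close>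

lemma card_unbalanced:
  assumes fin: "finite L" and D: "D \<subseteq> L" "8 \<le> card D"
  shows "real (card {S. S \<subseteq> L \<and> unbalanced D S}) \<le> 2 powr (card L - card D / 2)"
proof -
  let ?T = "{T. T \<subseteq> D \<and> 16 * card T < card D}"
  let ?A = "{S. S \<subseteq> L \<and> 16 * card (S \<inter> D) < card D}"
  let ?B = "{S. S \<subseteq> L \<and> 16 * card (D - S) < card D}"
  have finD: "finite D" using fin D finite_subset by blast
  have finT: "finite (?T \<times> Pow (L - D))" using fin finD by auto
  have "card ?A \<le> card (?T \<times> Pow (L - D))"
  proof (rule card_inj_on_le)
    show "inj_on (\<lambda>S. (S \<inter> D, S - D)) ?A" by (rule inj_onI) blast
  qed (use finT in auto)
  moreover have "card ?B \<le> card (?T \<times> Pow (L - D))"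
  proof (rule card_inj_on_le)
    show "inj_on (\<lambda>S. (D - S, S - D)) ?B" by (rule inj_onI) blast
  qed (use finT in auto)
  moreover have "{S. S \<subseteq> L \<and> unbalanced D S} = ?A \<union> ?B"
    by (auto simp: unbalanced_def)
  moreover have double: "2 * (2 powr a * 2 powr b) = 2 powr (1 + (a + b))" for a b :: real
    unfolding powr_add by (subst powr_one) auto
  ultimately have "card {S. S \<subseteq> L \<and> unbalanced D S} \<le> 2 * (card ?T * 2 ^ (card L - card D))"
    using card_Un_le[of ?A ?B] fin finD D by (simp add: card_cartesian_product card_Pow card_Diff_subset)
  then have "real (card {S. S \<subseteq> L \<and> unbalanced D S}) \<le> real (2 * (card ?T * 2 ^ (card L - card D)))"
    by (simp only: of_nat_le_iff)
  also have "\<dots> = 2 * (real (card ?T) * 2 ^ (card L - card D))"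
    by simp
  also have "\<dots> \<le> 2 * (2 powr (card D / 2 - 1) * 2 ^ (card L - card D))"
    by (intro mult_left_mono mult_right_mono card_small_subsets finD D) auto
  also have "2 ^ (card L - card D) = 2 powr (real (card L) - card D)"
    using card_mono[OF fin D(1)] by (simp add: powr_realpow[symmetric] of_nat_diff)
  also have "2 * (2 powr (card D / 2 - 1) * 2 powr (real (card L) - card D)) =
      2 powr (1 + (card D / 2 - 1 + (real (card L) - card D)))"
    by (rule double)
  also have "1 + (card D / 2 - 1 + (real (card L) - card D)) = card L - card D / 2"
    by simp
  finally show ?thesis .
qed

text \<open>The union bound over all \<open>Y\<close> is affordable because a point \<open>v\<close> is unbalanced only with
  probability exponentially small in the number of lines of \<open>Y\<close> through it, and these numbers add
  up to \<open>s * card Y\<close>.\<close>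

lemma ex_mostly_balanced:
  fixes P :: "'p set" and L :: "'p \<Rightarrow> 'l set"
  assumes finP: "finite P" and finN: "finite N" and L: "\<And>v. v \<in> P \<Longrightarrow> L v \<subseteq> N"
    and R: "0 < R" "16 * card P \<le> s * R"
    and y: "card N * 2 powr (- (s / 16)) \<le> 1 / 4"
  shows "\<exists>S. (\<forall>v\<in>P. S v \<subseteq> L v) \<and> (\<forall>Y\<subseteq>N. R \<le> card Y \<longrightarrow>
      4 * (\<Sum>v | v \<in> P \<and> 8 \<le> card (Y \<inter> L v) \<and> unbalanced (Y \<inter> L v) (S v). card (Y \<inter> L v))
        < s * card Y)"
proof (rule ccontr)
  assume contra: "\<not> ?thesis"
  \<comment> \<open>\<open>\<Omega>\<close> is the space of all choices, \<open>E Y B\<close> the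
    event that every \<open>v \<in> B\<close> splits \<open>Y \<inter> L v\<close> badly, and
    \<open>\<B> Y\<close> the family of point sets heavy enough to spoil \<open>Y\<close>.\<close>
  define \<Omega> where "\<Omega> = PiE P (\<lambda>v. Pow (L v))"
  define U where "U Y v = {S. S \<subseteq> L v \<and> unbalanced (Y \<inter> L v) S}" for Y v
  define E where "E Y B = PiE P (\<lambda>v. if v \<in> B then U Y v else Pow (L v))" for Y B
  define \<B> where "\<B> Y = {B. B \<subseteq> P \<and> (\<forall>v\<in>B. 8 \<le> card (Y \<inter> L v)) \<and>
      s * card Y \<le> 4 * (\<Sum>v\<in>B. card (Y \<inter> L v))}" for Y
  define \<Q> where "\<Q> = {Y. Y \<subseteq> N \<and> R \<le> card Y}"
  define y where "y = 2 powr (- (s / 16))"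
  have finL: "finite (L v)" if "v \<in> P" for v using L[OF that] finN finite_subset by blast
  have fin\<Q>: "finite \<Q>" unfolding \<Q>_def using finN by auto
  have fin\<B>: "finite (\<B> Y)" for Y
    unfolding \<B>_def by (rule finite_subset[of _ "Pow P"]) (use finP in auto)
  have card\<Omega>: "real (card \<Omega>) = (\<Prod>v\<in>P. 2 powr card (L v))"
    unfolding \<Omega>_def using finP finL by (simp add: card_PiE card_Pow powr_realpow)
  have fin\<Omega>: "finite \<Omega>" unfolding \<Omega>_def using finP finL by (intro finite_PiE) auto
  \<comment> \<open>Choices at different points are independent, so the savings
    \<open>2 powr (- (card (Y \<inter> L v) / 2))\<close> multiply over \<open>B\<close>, where the
    cardinalities sum to at least \<open>s * card Y / 4\<close>.\<close>
  have cE: "card (E Y B) \<le> card \<Omega> * 2 powr (- (s * card Y / 8))" if B: "B \<in> \<B> Y" for Y B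
  proof -
    have "real (card (E Y B)) = (\<Prod>v\<in>P. real (card (if v \<in> B then U Y v else Pow (L v))))"
      unfolding E_def using finP by (simp add: card_PiE)
    also have "\<dots> \<le> (\<Prod>v\<in>P. 2 powr (card (L v)) * 2 powr (if v \<in> B then - (card (Y \<inter> L v) / 2) else 0))"
    proof (rule prod_mono, rule conjI)
      fix v assume v: "v \<in> P"
      show "real (card (if v \<in> B then U Y v else Pow (L v))) \<le>
        2 powr (card (L v)) * 2 powr (if v \<in> B then - (card (Y \<inter> L v) / 2) else 0)"
        using card_unbalanced[OF finL[OF v], of "Y \<inter> L v"] B v finL[OF v]
        by (auto simp: U_def \<B>_def card_Pow powr_realpow[symmetric] powr_add[symmetric])
    qed simp
    also have "\<dots> = card \<Omega> * 2 powr (\<Sum>v\<in>P. if v \<in> B then - (card (Y \<inter> L v) / 2) else 0)"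
      by (simp add: prod.distrib card\<Omega> powr_sum)
    also have "(\<Sum>v\<in>P. if v \<in> B then - (card (Y \<inter> L v) / 2) else 0) = (\<Sum>v\<in>B. - (card (Y \<inter> L v) / 2))"
      using B finP by (intro sum.mono_neutral_cong_right) (auto simp: \<B>_def)
    also have "\<dots> = - (real (\<Sum>v\<in>B. card (Y \<inter> L v)) / 2)"
      by (simp add: sum_negf sum_divide_distrib)
    also have "card \<Omega> * 2 powr (- (real (\<Sum>v\<in>B. card (Y \<inter> L v)) / 2)) \<le>
        card \<Omega> * 2 powr (- (s * card Y / 8))"
    proof (intro mult_left_mono powr_mono)
      have "real (s * card Y) \<le> real (4 * (\<Sum>v\<in>B. card (Y \<inter> L v)))"
        using B unfolding \<B>_def of_nat_le_iff by simp
      then show "- (real (\<Sum>v\<in>B. card (Y \<inter> L v)) / 2) \<le> - (real (s * card Y) / 8)"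
        by simp
    qed auto
    finally show ?thesis .
  qed
  have "\<Omega> \<subseteq> (\<Union>Y\<in>\<Q>. \<Union>B\<in>\<B> Y. E Y B)"
  proof
    fix S assume S: "S \<in> \<Omega>"
    then have SL: "S v \<subseteq> L v" if "v \<in> P" for v using that by (auto simp: \<Omega>_def PiE_iff)
    then obtain Y where Y: "Y \<subseteq> N" "R \<le> card Y" "s * card Y \<le>
      4 * (\<Sum>v | v \<in> P \<and> 8 \<le> card (Y \<inter> L v) \<and> unbalanced (Y \<inter> L v) (S v). card (Y \<inter> L v))"
      using contra by (meson not_le)
    then have "{v. v \<in> P \<and> 8 \<le> card (Y \<inter> L v) \<and> unbalanced (Y \<inter> L v) (S v)} \<in> \<B> Y" (is "?B \<in> _")
      by (auto simp: \<B>_def)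
    moreover have "S \<in> E Y ?B"
      using S by (auto simp: E_def \<Omega>_def U_def PiE_iff)
    ultimately show "S \<in> (\<Union>Y\<in>\<Q>. \<Union>B\<in>\<B> Y. E Y B)" using Y by (auto simp: \<Q>_def)
  qed
  moreover have "finite (\<Union>Y\<in>\<Q>. \<Union>B\<in>\<B> Y. E Y B)"
  proof -
    have "E Y B \<subseteq> \<Omega>" for Y B
      unfolding E_def \<Omega>_def by (intro PiE_mono) (auto simp: U_def)
    then show ?thesis using fin\<Omega> by (meson UN_least finite_subset)
  qed
  ultimately have "card \<Omega> \<le> card (\<Union>Y\<in>\<Q>. \<Union>B\<in>\<B> Y. E Y B)"
    by (rule card_mono[rotated])
  also have "\<dots> \<le> (\<Sum>Y\<in>\<Q>. card (\<Union>B\<in>\<B> Y. E Y B))"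
    by (rule card_UN_le[OF fin\<Q>])
  also have "\<dots> \<le> (\<Sum>Y\<in>\<Q>. \<Sum>B\<in>\<B> Y. card (E Y B))"
    by (intro sum_mono card_UN_le fin\<B>)
  finally have "real (card \<Omega>) \<le> (\<Sum>Y\<in>\<Q>. \<Sum>B\<in>\<B> Y. real (card (E Y B)))"
    by (metis (mono_tags, lifting) of_nat_le_iff of_nat_sum sum.cong)
  also have "\<dots> \<le> (\<Sum>Y\<in>\<Q>. \<Sum>B\<in>\<B> Y. card \<Omega> * 2 powr (- (s * card Y / 8)))"
    by (intro sum_mono cE)
  also have "\<dots> = (\<Sum>Y\<in>\<Q>. card \<Omega> * (card (\<B> Y) * 2 powr (- (s * card Y / 8))))"
    by (simp add: mult_ac)
  \<comment> \<open>There are at most \<open>2 ^ card P\<close> sets \<open>B\<close>, and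
    \<open>card P \<le> s * card Y / 16\<close> by the choice of \<open>R\<close>, so half of the
    exponent survives.\<close>
  also have "\<dots> \<le> (\<Sum>Y\<in>\<Q>. card \<Omega> * y ^ card Y)"
  proof (intro sum_mono mult_left_mono)
    fix Y assume Y: "Y \<in> \<Q>"
    have "card (\<B> Y) \<le> card (Pow P)"
      by (rule card_mono) (use finP in \<open>auto simp: \<B>_def\<close>)
    then have "real (card (\<B> Y)) \<le> 2 powr card P"
      using finP by (simp add: card_Pow powr_realpow)
    then have "card (\<B> Y) * 2 powr (- (s * card Y / 8)) \<le> 2 powr card P * 2 powr (- (s * card Y / 8))"
      by (rule mult_right_mono) simp
    also have "\<dots> = 2 powr (card P - s * card Y / 8)"
      by (simp add: powr_add[symmetric])
    also have "\<dots> \<le> 2 powr (- (s / 16) * card Y)"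
    proof (rule powr_mono)
      have "16 * card P \<le> s * card Y"
        using R Y by (auto simp: \<Q>_def intro: order_trans mult_le_mono2)
      then have "16 * real (card P) \<le> s * card Y"
        by (metis of_nat_le_iff of_nat_mult of_nat_numeral)
      then show "card P - real (s * card Y) / 8 \<le> - (s / 16) * card Y" by simp
    qed simp
    also have "\<dots> = y ^ card Y"
      by (simp add: y_def powr_powr powr_realpow[symmetric])
    finally show "card (\<B> Y) * 2 powr (- (s * card Y / 8)) \<le> y ^ card Y" .
  qed simp
  also have "\<dots> = card \<Omega> * (\<Sum>Y\<in>\<Q>. y ^ card Y)"
    by (simp add: sum_distrib_left)
  \<comment> \<open>\<open>0 < R\<close> excludes the empty set, whose term 1 would already exhaust
    the bound.\<close>
  also have "\<dots> \<le> card \<Omega> * (\<Sum>Y\<in>Pow N - {{}}. y ^ card Y)"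
    by (intro mult_left_mono sum_mono2) (use R finN in \<open>auto simp: \<Q>_def y_def\<close>)
  also have "(\<Sum>Y\<in>Pow N - {{}}. y ^ card Y) = (1 + y) ^ card N - 1"
    using sum_Pow_power_card[OF finN, of y] sum.remove[of "Pow N" "{}" "\<lambda>Y. y ^ card Y"] finN by simp
  also have "card \<Omega> * ((1 + y) ^ card N - 1) < real (card \<Omega>) * 1"
  proof (rule mult_strict_left_mono)
    have "(1 + y) ^ card N \<le> exp y ^ card N"
      by (intro power_mono exp_ge_add_one_self) (simp add: y_def)
    also have "\<dots> = exp (card N * y)" by (simp add: exp_of_nat_mult)
    also have "\<dots> < exp (1 / 2)" using y by (simp add: y_def)
    also have "\<dots> \<le> 2" by (rule exp_half_le2)
    finally show "(1 + y) ^ card N - 1 < 1" by simp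
    show "0 < real (card \<Omega>)" unfolding card\<Omega> by (intro prod_pos) simp
  qed
  finally show False by simp
qed

text \<open>By double counting, the numbers \<open>card (Y \<inter> L v)\<close> sum to
  \<open>s * card Y\<close>. Points with fewer than 8 lines carry at most a quarter of this by
  \<open>large\<close>, badly split points at most a quarter by \<open>bal\<close>. At the others
  the number of pairs is quadratic in the number of lines, and Cauchy-Schwarz applies.\<close>

lemma bipartite_edges_ge:
  fixes P :: "'p set" and L :: "'p \<Rightarrow> 'l set"
  assumes finP: "finite P" and finX: "finite Y"
    and s: "\<And>l. l \<in> Y \<Longrightarrow> card {v\<in>P. l \<in> L v} = s"
    and large: "32 * card P \<le> s * card Y"
    and bal: "4 * (\<Sum>v | v \<in> P \<and> 8 \<le> card (Y \<inter> L v) \<and> unbalanced (Y \<inter> L v) (S v). card (Y \<inter> L v))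
        < s * card Y"
  shows "(s * card Y)\<^sup>2 \<le> 128 * card P * (\<Sum>v\<in>P. card (S v \<inter> (Y \<inter> L v)) * card ((Y \<inter> L v) - S v))"
proof -
  define d where "d v = card (Y \<inter> L v)" for v
  define e where "e v = card (S v \<inter> (Y \<inter> L v)) * card ((Y \<inter> L v) - S v)" for v
  define B where "B = {v. v \<in> P \<and> 8 \<le> d v \<and> unbalanced (Y \<inter> L v) (S v)}"
  define G where "G = {v. v \<in> P \<and> 8 \<le> d v \<and> \<not> unbalanced (Y \<inter> L v) (S v)}"
  define C where "C = {v. v \<in> P \<and> d v < 8}"
  have "(\<Sum>v\<in>P. d v) = (\<Sum>v\<in>P. \<Sum>l\<in>Y. if l \<in> L v then 1 else 0)"
    unfolding d_def using finX by (simp add: sum.If_cases Int_def)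
  also have "\<dots> = (\<Sum>l\<in>Y. \<Sum>v\<in>P. if l \<in> L v then 1 else 0)"
    by (rule sum.swap)
  also have "\<dots> = (\<Sum>l\<in>Y. s)"
    using s finP by (intro sum.cong) (auto simp: sum.If_cases Int_def)
  finally have total: "(\<Sum>v\<in>P. d v) = s * card Y" by simp
  have "P = G \<union> B \<union> C" by (auto simp: G_def B_def C_def)
  then have "(\<Sum>v\<in>P. d v) = (\<Sum>v\<in>G \<union> B \<union> C. d v)" by simp
  also have "\<dots> = (\<Sum>v\<in>G. d v) + (\<Sum>v\<in>B. d v) + (\<Sum>v\<in>C. d v)"
    by (subst sum.union_disjoint | (use finP in \<open>force simp: G_def B_def C_def\<close>))+
  finally have split: "s * card Y = (\<Sum>v\<in>G. d v) + (\<Sum>v\<in>B. d v) + (\<Sum>v\<in>C. d v)"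
    using total by simp
  have "(\<Sum>v\<in>C. d v) \<le> (\<Sum>v\<in>C. 8)"
    by (intro sum_mono) (auto simp: C_def)
  also have "\<dots> \<le> 8 * card P"
    using finP by (auto simp: C_def intro: card_mono)
  finally have "4 * (\<Sum>v\<in>C. d v) \<le> s * card Y" using large by linarith
  moreover have "4 * (\<Sum>v\<in>B. d v) \<le> s * card Y"
    using bal by (simp add: B_def d_def)
  ultimately have half: "s * card Y \<le> 2 * (\<Sum>v\<in>G. d v)"
    using split by linarith
  have e: "15 * (d v)\<^sup>2 \<le> 256 * e v" if "v \<in> G" for v
  proof -
    define a b where "a = real (card (S v \<inter> (Y \<inter> L v)))" and "b = real (card ((Y \<inter> L v) - S v))"
    have "card (S v \<inter> (Y \<inter> L v)) + card ((Y \<inter> L v) - S v) = card (Y \<inter> L v)"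
      using card_Int_Diff[of "Y \<inter> L v" "S v"] finX by (simp add: Int_commute)
    then have "real (d v) = a + b" by (simp add: d_def a_def b_def flip: of_nat_add)
    moreover have "d v \<le> 16 * a" "d v \<le> 16 * b"
      using that by (auto simp: G_def unbalanced_def d_def a_def b_def)
    \<comment> \<open>With \<open>d v = a + b\<close> this product equals
      \<open>256 * a * b - 15 * (d v)^2\<close>.\<close>
    ultimately have "0 \<le> (16 * a - d v) * (16 * b - d v)" "real (d v) = a + b"
      by auto
    then have "15 * (real (d v))\<^sup>2 \<le> 256 * (a * b)"
      by (simp add: algebra_simps power2_eq_square)
    also have "a * b = real (e v)" by (simp add: e_def a_def b_def)
    finally have "real (15 * (d v)\<^sup>2) \<le> real (256 * e v)" by simp
    then show ?thesis by linarith
  qed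
  have GP: "G \<subseteq> P" by (auto simp: G_def)
  have "(\<Sum>v\<in>G. real (d v))\<^sup>2 \<le> (\<Sum>v\<in>G. (real (d v))\<^sup>2) * card G"
    by (rule sum_squared_le_sum_of_squares)
  then have "real ((\<Sum>v\<in>G. d v)\<^sup>2) \<le> real ((\<Sum>v\<in>G. (d v)\<^sup>2) * card G)"
    by simp
  then have "(\<Sum>v\<in>G. d v)\<^sup>2 \<le> (\<Sum>v\<in>G. (d v)\<^sup>2) * card G"
    by linarith
  then have "15 * (\<Sum>v\<in>G. d v)\<^sup>2 \<le> (\<Sum>v\<in>G. 15 * (d v)\<^sup>2) * card G"
    by (simp add: sum_distrib_left[symmetric])
  also have "\<dots> \<le> (\<Sum>v\<in>P. 256 * e v) * card P"
  proof (rule mult_le_mono)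
    have "(\<Sum>v\<in>G. 15 * (d v)\<^sup>2) \<le> (\<Sum>v\<in>G. 256 * e v)"
      by (intro sum_mono e)
    also have "\<dots> \<le> (\<Sum>v\<in>P. 256 * e v)"
      by (rule sum_mono2) (use finP GP in auto)
    finally show "(\<Sum>v\<in>G. 15 * (d v)\<^sup>2) \<le> (\<Sum>v\<in>P. 256 * e v)" .
    show "card G \<le> card P" by (rule card_mono[OF finP GP])
  qed
  finally have *: "15 * (\<Sum>v\<in>G. d v)\<^sup>2 \<le> 256 * (card P * (\<Sum>v\<in>P. e v))"
    unfolding sum_distrib_left[symmetric] by (simp add: mult_ac)
  have "(s * card Y)\<^sup>2 \<le> (2 * (\<Sum>v\<in>G. d v))\<^sup>2"
    by (rule power_mono[OF half]) simp
  \<comment> \<open>The constant \<open>4 * 256 / 15\<close> is rounded up generously.\<close>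
  then have "(s * card Y)\<^sup>2 \<le> 128 * (card P * (\<Sum>v\<in>P. e v))"
    using * by (simp add: power_mult_distrib)
  then show ?thesis by (simp add: e_def mult.assoc)
qed

section \<open>The affine Hermitian curve in characteristic two\<close>

text \<open>A multiple root would also be a root of the derivative, so the linear factors of
  \<open>p\<close> are distinct.\<close>

lemma card_roots_eq_degree:
  fixes p :: "'a :: alg_closed_field poly"
  assumes "\<And>x. poly p x = 0 \<Longrightarrow> poly (pderiv p) x \<noteq> 0"
  shows "card {x. poly p x = 0} = Polynomial.degree p"
proof -
  have p0: "p \<noteq> 0" using assms[of 0] by auto
  obtain A where A: "size A = Polynomial.degree p" "p = Polynomial.smult (Polynomial.lead_coeff p) (\<Prod>x\<in>#A. [:-x, 1:])"
    using alg_closed_imp_factorization[OF p0] by blast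
  have roots: "{x. poly p x = 0} = set_mset A"
  proof -
    have "poly p x = Polynomial.lead_coeff p * (\<Prod>y\<in>#A. x - y)" for x
      by (subst A(2)) (simp add: poly_prod_mset)
    then show ?thesis using p0 by (auto simp: prod_mset_zero_iff)
  qed
  have "count A x \<le> 1" for x
  proof (rule ccontr)
    assume "\<not> count A x \<le> 1"
    then have "{#x, x#} \<subseteq># A"
      by (simp add: subseteq_mset_def)
    then obtain B where B: "A = {#x, x#} + B"
      by (metis mset_subset_eq_exists_conv)
    define h where "h = Polynomial.smult (Polynomial.lead_coeff p) (\<Prod>x\<in>#B. [:-x, 1:])"
    have "p = [:-x, 1:] * ([:-x, 1:] * h)"
      by (subst A(2)) (simp add: B h_def mult_ac)
    moreover have "poly ([:-x, 1:] * ([:-x, 1:] * h)) x = 0"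
      "poly (pderiv ([:-x, 1:] * ([:-x, 1:] * h))) x = 0"
      by (simp_all only: pderiv_mult poly_add poly_mult) simp_all
    ultimately have "poly p x = 0" "poly (pderiv p) x = 0"
      by simp_all
    then show False using assms by blast
  qed
  then have "count A x = 1" if "x \<in># A" for x
    using that by (metis One_nat_def count_greater_zero_iff le_antisym Suc_leI)
  then have "size A = card (set_mset A)"
    by (simp add: size_multiset_overloaded_eq)
  then show ?thesis using A(1) roots by simp
qed

lemma CHAR_bit [simp]: "CHAR(bit) = 2"
proof (rule CHAR_eqI)
  fix n assume "of_nat n = (0 :: bit)"
  then show "2 dvd n"
    by (cases "even n") (auto elim!: oddE)
qed simp

text \<open>One field containing all finite fields of characteristic two: the field of order
  \<open>q * q\<close> becomes a set in it, and no type has to depend on \<open>k\<close>.\<close>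

type_synonym F = "bit alg_closure"

lemma two_F: "(2 :: F) = 0"
  using of_nat_CHAR[where 'a = F] by simp

lemma minus_F: "- x = (x :: F)"
  using two_F by (metis add_eq_0_iff mult_2 mult_zero_left)

lemma diff_F: "x - y = (x + y :: F)"
  by (metis diff_conv_add_uminus minus_F)

lemma add_self_F: "x + x = (0 :: F)"
  using two_F by (metis mult_2 mult_zero_left)

lemma add_eq_0_F: "x + y = 0 \<longleftrightarrow> x = (y :: F)"
  by (metis add_self_F add_right_cancel)

lemma add_power_F: "(x + y :: F) ^ (2 ^ k) = x ^ (2 ^ k) + y ^ (2 ^ k)"
  by (rule freshmans_dream'[where n = k]) (auto simp: two_is_prime_nat)

text \<open>For odd \<open>n\<close> the derivative \<open>n * z ^ (n - 1)\<close> vanishes at most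
  at 0, which is no root. Serves both for the order of the field, \<open>n = q * q - 1\<close>, and
  for the points on a secant, \<open>n = q + 1\<close>.\<close>

lemma card_roots_of_odd:
  assumes "odd n" and "c \<noteq> 0"
  shows "card {z :: F. z ^ n = c} = n"
proof -
  define p where "p = Polynomial.monom 1 n - [:c:]"
  have poly_p: "poly p z = z ^ n - c" for z by (simp add: p_def poly_monom)
  have "n > 0" using assms(1) by (cases n) auto
  have "Polynomial.degree p = n"
    unfolding p_def using \<open>n > 0\<close>
    by (subst diff_conv_add_uminus, subst degree_add_eq_left) (auto simp: degree_monom_eq)
  moreover have "card {z. poly p z = 0} = Polynomial.degree p"
  proof (rule card_roots_eq_degree)
    fix x assume "poly p x = 0"
    then have "x \<noteq> 0" using assms \<open>n > 0\<close> by (auto simp: poly_p power_0_left)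
    moreover have "(of_nat n :: F) \<noteq> 0"
      using assms(1) unfolding of_nat_eq_0_iff_char_dvd by simp
    ultimately show "poly (pderiv p) x \<noteq> 0"
      by (simp add: p_def pderiv_diff pderiv_monom poly_monom)
  qed
  ultimately show ?thesis by (simp add: poly_p)
qed

section \<open>O'Nan configurations of isotropic points\<close>

text \<open>A Hermitian Gram determinant: the rows \<open>(x, y, 1)\<close> of a matrix \<open>M\<close>, their conjugates
  \<open>(x', y', 1)\<close> and the isotropic form \<open>x x' + y + y'\<close>.\<close>

lemma gram_det:
  fixes x1 :: "'a :: comm_ring_1"
  assumes "y1 + y1' + x1 * x1' = 0" "y2 + y2' + x2 * x2' = 0" "y3 + y3' + x3 * x3' = 0"
  shows "(y1 + y2' + x1 * x2') * (y2 + y3' + x2 * x3') * (y3 + y1' + x3 * x1') +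
         (y2 + y1' + x2 * x1') * (y3 + y2' + x3 * x2') * (y1 + y3' + x1 * x3') =
     - ((x1 * (y2 - y3) + x2 * (y3 - y1) + x3 * (y1 - y2)) *
        (x1' * (y2' - y3') + x2' * (y3' - y1') + x3' * (y1' - y2')))"
proof -
  have y': "y1' = - y1 - x1 * x1'" "y2' = - y2 - x2 * x2'" "y3' = - y3 - x3 * x3'"
    using assms by (simp_all add: eq_neg_iff_add_eq_0 algebra_simps)
  show ?thesis unfolding y' by (simp add: algebra_simps)
qed

text \<open>Abstracts \<open>x \<mapsto> x ^ q\<close>, which is additive and multiplicative on all
  of \<open>F\<close> but an involution only on the subset \<open>K\<close>; hence the membership
  assumptions below.\<close>

locale frobenius_involution =
  fixes c :: "F \<Rightarrow> F" and K :: "F set"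
  assumes c_add: "c (x + y) = c x + c y"
    and c_mult: "c (x * y) = c x * c y"
    and c_c: "x \<in> K \<Longrightarrow> c (c x) = x"
begin

text \<open>The Hermitian form on vectors \<open>(x, y, 1)\<close> for which the second and third
  coordinates form a hyperbolic pair.\<close>

definition form :: "F \<times> F \<Rightarrow> F \<times> F \<Rightarrow> F" where
  "form p p' = snd p + c (snd p') + fst p * c (fst p')"

lemma c_zero [simp]: "c 0 = 0"
  by (metis add_0 add_self_F c_add)

lemma c_form:
  assumes "p' \<in> K \<times> K"
  shows "c (form p p') = form p' p"
  using assms by (auto simp: form_def c_add c_mult c_c algebra_simps)

text \<open>The points \<open>U\<close>, \<open>V\<close>, \<open>W\<close> of the line over
  \<open>u\<close>, \<open>v\<close>, \<open>w\<close> satisfy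
  \<open>(v - u) W = (v - w) U + (w - u) V\<close>. Expanding the form at \<open>W\<close> leaves
  only the two mixed terms, which in characteristic two are \<open>t\<close> and its conjugate, and
  their sum is 0.\<close>

lemma collinear_isotropic:
  assumes K: "v \<in> K" "u \<in> K" "w \<in> K" "a * u + b \<in> K" "a * v + b \<in> K"
    and iso: "form (u, a * u + b) (u, a * u + b) = 0" "form (v, a * v + b) (v, a * v + b) = 0"
      "form (w, a * w + b) (w, a * w + b) = 0"
  defines "t \<equiv> (w - v) * c (w - u) * form (u, a * u + b) (v, a * v + b)"
  shows "c t = t"
proof -
  have ring: "(v - u) * (v' - u') * ((a * w + b) + (a' * w' + b') + w * w') =
      (v - w) * (v' - w') * ((a * u + b) + (a' * u' + b') + u * u') +
      (w - u) * (w' - u') * ((a * v + b) + (a' * v' + b') + v * v') +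
      (v - w) * (w' - u') * ((a * u + b) + (a' * v' + b') + u * v') +
      (w - u) * (v' - w') * ((a * v + b) + (a' * u' + b') + v * u')"
    for u' v' w' a' b' :: F
    by (simp add: algebra_simps)
  have "(v - w) * (c w - c u) * form (u, a * u + b) (v, a * v + b) +
      (w - u) * (c v - c w) * form (v, a * v + b) (u, a * u + b) = 0"
    using ring[of "c v" "c u" "c a" "c w" "c b"] iso
    by (simp add: form_def c_add c_mult)
  moreover have "c t = (c w - c v) * (w - u) * form (v, a * v + b) (u, a * u + b)"
    using K by (simp add: t_def c_mult c_form diff_F c_add c_c)
  ultimately have "t + c t = 0"
    by (simp add: t_def diff_F c_add add_ac mult_ac)
  then show ?thesis by (metis add_eq_0_iff minus_F)
qed

text \<open>Menelaus' theorem reduces the configuration to the vanishing of the Gram determinant of the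
  three intersection points on the first three lines.\<close>

lemma no_ONan_configuration:
  assumes K: "x12 \<in> K" "x13 \<in> K" "x23 \<in> K" "x14 \<in> K" "x24 \<in> K" "x34 \<in> K"
      "a1 * x12 + b1 \<in> K" "a1 * x13 + b1 \<in> K" "a2 * x23 + b2 \<in> K"
    and eq: "a1 * x12 + b1 = a2 * x12 + b2" "a1 * x13 + b1 = a3 * x13 + b3"
      "a2 * x23 + b2 = a3 * x23 + b3" "a1 * x14 + b1 = a4 * x14 + b4"
      "a2 * x24 + b2 = a4 * x24 + b4" "a3 * x34 + b3 = a4 * x34 + b4"
    and iso: "form (x12, a1 * x12 + b1) (x12, a1 * x12 + b1) = 0"
      "form (x13, a1 * x13 + b1) (x13, a1 * x13 + b1) = 0"
      "form (x23, a2 * x23 + b2) (x23, a2 * x23 + b2) = 0"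
      "form (x14, a1 * x14 + b1) (x14, a1 * x14 + b1) = 0"
      "form (x24, a2 * x24 + b2) (x24, a2 * x24 + b2) = 0"
      "form (x34, a3 * x34 + b3) (x34, a3 * x34 + b3) = 0"
    and neq: "a1 \<noteq> a4" "a2 \<noteq> a4" "a3 \<noteq> a4" "x14 \<noteq> x13" "x34 \<noteq> x23" "x24 \<noteq> x12"
      "x12 \<noteq> x13" "a1 * x23 + b1 \<noteq> a2 * x23 + b2"
  shows False
proof -
  define p q r where "p = (x12, a1 * x12 + b1)" and "q = (x13, a1 * x13 + b1)"
    and "r = (x23, a2 * x23 + b2)"
  have pqr: "p \<in> K \<times> K" "q \<in> K \<times> K" "r \<in> K \<times> K"
    using K by (auto simp: p_def q_def r_def)
  define \<alpha> where "\<alpha> = (x14 - x13) * (x34 - x23) * (x24 - x12)"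
  define H where "H = form p q * form q r * form r p"
  define t1 t2 t3 where "t1 = (x14 - x13) * c (x14 - x12) * form p q"
    and "t2 = (x34 - x23) * c (x34 - x13) * form q r"
    and "t3 = (x24 - x12) * c (x24 - x23) * form r p"
  have "c t1 = t1"
    using collinear_isotropic[of x13 x12 x14 a1 b1] K iso by (simp add: t1_def p_def q_def)
  moreover have "c t2 = t2"
    using collinear_isotropic[of x23 x13 x34 a3 b3] K iso eq by (simp add: t2_def q_def r_def)
  moreover have "c t3 = t3"
    using collinear_isotropic[of x12 x23 x24 a2 b2] K iso eq by (simp add: t3_def r_def p_def)
  moreover have t: "\<alpha> * c ((x14 - x12) * (x34 - x13) * (x24 - x23)) * H = t1 * t2 * t3"
    by (simp only: \<alpha>_def H_def c_mult t1_def t2_def t3_def mult_ac)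
  ultimately have fixed: "c (\<alpha> * c ((x14 - x12) * (x34 - x13) * (x24 - x23)) * H) =
      \<alpha> * c ((x14 - x12) * (x34 - x13) * (x24 - x23)) * H"
    unfolding t by (simp only: c_mult)
  have cross: "(a - a4) * (x - y) = (a' - a4) * (x' - y)"
    if "a * x + b = a4 * x + b4" "a' * x' + b' = a4 * x' + b4" "a * y + b = a' * y + b'"
    for a b a' b' x x' y :: F
  proof -
    have "(a - a4) * (x - y) = (a * x + b - (a4 * x + b4)) - (a * y + b - (a4 * y + b4))"
      by (simp add: algebra_simps)
    also have "\<dots> = (a' * x' + b' - (a4 * x' + b4)) - (a' * y + b' - (a4 * y + b4))"
      using that by simp
    also have "\<dots> = (a' - a4) * (x' - y)"
      by (simp add: algebra_simps)
    finally show ?thesis .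
  qed
  have "(a1 - a4) * (x14 - x13) = (a3 - a4) * (x34 - x13)"
    "(a3 - a4) * (x34 - x23) = (a2 - a4) * (x24 - x23)"
    "(a2 - a4) * (x24 - x12) = (a1 - a4) * (x14 - x12)"
    using eq by (auto intro!: cross)
  then have "((a1 - a4) * (x14 - x13)) * ((a3 - a4) * (x34 - x23)) * ((a2 - a4) * (x24 - x12)) =
      ((a3 - a4) * (x34 - x13)) * ((a2 - a4) * (x24 - x23)) * ((a1 - a4) * (x14 - x12))"
    by (simp only:)
  then have "((a1 - a4) * (a2 - a4) * (a3 - a4)) * \<alpha> =
      ((a1 - a4) * (a2 - a4) * (a3 - a4)) * ((x14 - x12) * (x34 - x13) * (x24 - x23))"
    unfolding \<alpha>_def by (simp only: mult_ac)
  then have menelaus: "(x14 - x12) * (x34 - x13) * (x24 - x23) = \<alpha>"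
    using neq by simp
  \<comment> \<open>By \<open>menelaus\<close> the coefficient of \<open>H\<close> in
    \<open>fixed\<close> is \<open>\<alpha> * c \<alpha>\<close>, which \<open>c\<close> fixes;
    cancelling it leaves \<open>c H = H\<close>.\<close>
  have c\<alpha>: "c (c \<alpha>) = \<alpha>"
    using K by (simp add: \<alpha>_def c_mult c_add diff_F c_c)
  have "\<alpha> \<noteq> 0" using neq by (simp add: \<alpha>_def)
  moreover have "c \<alpha> \<noteq> 0"
    using c\<alpha> \<open>\<alpha> \<noteq> 0\<close> by auto
  ultimately have "c H = H"
    using fixed by (simp add: menelaus c_mult c\<alpha>)
  moreover have "c H = form q p * form r q * form p r"
    unfolding H_def c_mult using pqr by (simp add: c_form)
  ultimately have "form p q * form q r * form r p + form q p * form r q * form p r = 0"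
    unfolding H_def[symmetric] by (simp add: add_self_F)
  moreover define d where "d = x12 * (snd q - snd r) + x13 * (snd r - snd p) + x23 * (snd p - snd q)"
  have "form p q * form q r * form r p + form q p * form r q * form p r = - (d * c d)"
    using gram_det[of "snd p" "c (snd p)" x12 "c x12" "snd q" "c (snd q)" x13 "c x13"
        "snd r" "c (snd r)" x23 "c x23"] iso
    unfolding form_def d_def c_add c_mult diff_F by (simp add: p_def q_def r_def)
  ultimately have "d = 0 \<or> c d = 0" by simp
  moreover have "c (c d) = d"
    using K pqr by (simp add: d_def c_mult c_add diff_F c_c mem_Times_iff)
  ultimately have "d = 0" by (metis c_zero)
  moreover have "d = (x12 - x13) * ((a1 * x23 + b1) - (a2 * x23 + b2))"
    by (simp add: d_def p_def q_def r_def algebra_simps)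
  ultimately show False using neq by simp
qed

end


section \<open>Points and secants of the curve over the field with \<open>q * q\<close>
  elements\<close>

text \<open>For \<open>q = 2 ^ k\<close> this is the field with \<open>q\<^sup>2\<close> elements, inside the algebraic closure of the
  field with two elements; the conjugation is \<open>x \<mapsto> x ^ q\<close>.\<close>

definition sq_field :: "nat \<Rightarrow> F set" where
  "sq_field q = {x. x ^ (q * q) = x}"

text \<open>In characteristic two the equation says \<open>form p p = 0\<close>, with the power
  \<open>q\<close> as conjugation.\<close>

definition unital :: "nat \<Rightarrow> (F \<times> F) set" where
  "unital q = {(x, y). x \<in> sq_field q \<and> y \<in> sq_field q \<and> y ^ q + y = x ^ (q + 1)}"

text \<open>A pair \<open>(a, b)\<close> encodes the line \<open>y = a * x + b\<close>. It is a secant of the affine Hermitian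
  curve \<open>unital q\<close> iff it is not, as a point, on that curve.\<close>

definition secants :: "nat \<Rightarrow> (F \<times> F) set" where
  "secants q = sq_field q \<times> sq_field q - unital q"

definition on_line :: "F \<times> F \<Rightarrow> F \<times> F \<Rightarrow> bool" where
  "on_line p l \<longleftrightarrow> snd p = fst l * fst p + snd l"

lemma two_lines_meet_once:
  assumes "l \<noteq> l'" "on_line p l" "on_line p l'" "on_line p' l" "on_line p' l'"
  shows "p = p'"
proof (rule ccontr)
  assume "p \<noteq> p'"
  then have ne: "fst p \<noteq> fst p'"
    using assms by (auto simp: on_line_def prod_eq_iff)
  have "(fst l - fst l') * (fst p - fst p') =
      (fst l * fst p + snd l - (fst l' * fst p + snd l')) -
      (fst l * fst p' + snd l - (fst l' * fst p' + snd l'))"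
    by (simp add: algebra_simps)
  also have "\<dots> = 0"
    using assms(2-5) by (simp add: on_line_def)
  finally have "(fst l - fst l') * (fst p - fst p') = 0" .
  then have "fst l = fst l'" using ne by simp
  then show False using assms by (auto simp: on_line_def prod_eq_iff)
qed

context
  fixes k q :: nat
  assumes k: "k > 0" and q: "q = 2 ^ k"
begin

lemma q_ge: "q \<ge> 2"
  using k q self_le_power[of 2 k] by simp

lemma even_q: "even q"
  using k q by simp

lemma add_power_q: "(x + y :: F) ^ q = x ^ q + y ^ q"
  unfolding q by (rule add_power_F)

lemma frobenius_involution: "frobenius_involution (\<lambda>x. x ^ q) (sq_field q)"
  by unfold_locales (auto simp: add_power_q power_mult_distrib sq_field_def power_mult)

lemma sq_field_closed:
  assumes "x \<in> sq_field q" "y \<in> sq_field q"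
  shows "x + y \<in> sq_field q" "x * y \<in> sq_field q" "x ^ n \<in> sq_field q"
proof -
  show "x + y \<in> sq_field q" "x * y \<in> sq_field q"
    using assms by (simp_all add: sq_field_def power_mult add_power_q power_mult_distrib)
  have "(x ^ n) ^ (q * q) = (x ^ (q * q)) ^ n"
    by (simp flip: power_mult add: mult.commute)
  then show "x ^ n \<in> sq_field q"
    using assms(1) by (simp add: sq_field_def)
qed

text \<open>Zero together with the roots of \<open>z ^ (q * q - 1) = 1\<close>, whose exponent is
  odd.\<close>

lemma card_sq_field: "card (sq_field q) = q ^ 2"
proof -
  have qq: "q * q = Suc (q * q - 1)" "odd (q * q - 1)"
    using q_ge even_q by auto
  have "sq_field q = insert 0 {z. z ^ (q * q - 1) = 1}"
  proof -
    have "x ^ (q * q) = x * x ^ (q * q - 1)" for x :: F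
      by (subst qq(1)) (rule power_Suc)
    then show ?thesis by (auto simp: sq_field_def)
  qed
  moreover have "card {z :: F. z ^ (q * q - 1) = 1} = q * q - 1"
    by (rule card_roots_of_odd[OF qq(2)]) simp
  moreover have "finite {z :: F. z ^ (q * q - 1) = 1}"
    using calculation(2) odd_pos[OF qq(2)] by (metis card_ge_0_finite)
  moreover have "0 \<notin> {z :: F. z ^ (q * q - 1) = 1}"
    using odd_pos[OF qq(2)] by (simp add: power_0_left)
  ultimately have "card (sq_field q) = Suc (q * q - 1)"
    by (metis card_insert_disjoint)
  then show ?thesis
    using qq(1) by (simp add: power2_eq_square)
qed

lemma finite_sq_field: "finite (sq_field q)"
  using card_sq_field q_ge by (simp add: card_ge_0_finite)

lemma finite_unital: "finite (unital q)"
  by (rule finite_subset[of _ "sq_field q \<times> sq_field q"])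
    (auto simp: unital_def finite_sq_field)

lemma finite_secants: "finite (secants q)"
  unfolding secants_def using finite_sq_field by simp

text \<open>Over each \<open>x\<close> lie at most \<open>q\<close> points, as
  \<open>y ^ q + y\<close> has degree \<open>q\<close> in \<open>y\<close>.\<close>

lemma card_unital_le: "card (unital q) \<le> q ^ 3"
proof -
  have fib: "card {y :: F. y ^ q + y = c} \<le> q" "finite {y :: F. y ^ q + y = c}" for c
  proof -
    define f :: "F poly" where "f = Polynomial.monom 1 q + (Polynomial.monom 1 1 - [:c:])"
    have "Polynomial.degree (Polynomial.monom 1 1 - [:c:]) \<le> 1"
      by (rule degree_diff_le) (auto simp: degree_monom_le)
    then have deg: "Polynomial.degree f = q"
      unfolding f_def using q_ge by (subst degree_add_eq_left) (auto simp: degree_monom_eq)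
    then have "f \<noteq> 0" using q_ge by auto
    moreover have "{y. poly f y = 0} = {y :: F. y ^ q + y = c}"
      by (auto simp: f_def poly_monom algebra_simps)
    ultimately show "card {y :: F. y ^ q + y = c} \<le> q" "finite {y :: F. y ^ q + y = c}"
      using card_poly_roots_bound[of f] poly_roots_finite[of f] deg by auto
  qed
  have "unital q \<subseteq> Sigma (sq_field q) (\<lambda>x. {y. y ^ q + y = x ^ (q + 1)})"
    by (auto simp: unital_def)
  then have "card (unital q) \<le> card (Sigma (sq_field q) (\<lambda>x. {y. y ^ q + y = x ^ (q + 1)}))"
    by (rule card_mono[rotated]) (use finite_sq_field fib in auto)
  also have "\<dots> = (\<Sum>x\<in>sq_field q. card {y. y ^ q + y = x ^ (q + 1)})"
    using finite_sq_field fib by simp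
  also have "\<dots> \<le> (\<Sum>x\<in>sq_field q. q)"
    by (intro sum_mono fib)
  also have "\<dots> = q ^ 3"
    by (simp add: card_sq_field power3_eq_cube power2_eq_square)
  finally show ?thesis .
qed

lemma card_secants: "q ^ 4 - q ^ 3 \<le> card (secants q)" "card (secants q) \<le> q ^ 4"
proof -
  have c: "card (sq_field q \<times> sq_field q) = q ^ 4"
    by (simp add: card_cartesian_product card_sq_field flip: power_add)
  show "card (secants q) \<le> q ^ 4"
    unfolding c[symmetric] secants_def using finite_sq_field by (intro card_mono) auto
  have "card (secants q) = q ^ 4 - card (unital q)"
    unfolding secants_def c[symmetric]
    by (rule card_Diff_subset) (auto simp: finite_unital, auto simp: unital_def)
  then show "q ^ 4 - q ^ 3 \<le> card (secants q)"
    using card_unital_le by simp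
qed

text \<open>On the line \<open>y = a * x + b\<close>, substituting \<open>x = z + a ^ q\<close>
  turns the equation of the curve into \<open>z ^ (q + 1) = \<kappa>\<close>. Here
  \<open>\<kappa> \<noteq> 0\<close> says exactly that \<open>(a, b)\<close> is off the curve, and
  \<open>q + 1\<close> is odd.\<close>

lemma card_points_on_secant:
  assumes l: "l \<in> secants q"
  shows "card {p \<in> unital q. on_line p l} = q + 1"
proof -
  interpret frobenius_involution "\<lambda>x. x ^ q" "sq_field q" by (rule frobenius_involution)
  obtain a b where l_eq: "l = (a, b)" by (cases l)
  have "a ^ (q + 1) + b ^ q + b = 0 \<longleftrightarrow> b ^ q + b = a ^ (q + 1)"
    by (metis add_eq_0_F add.assoc)
  then have ab: "l = (a, b)" "a \<in> sq_field q" "b \<in> sq_field q" "a ^ (q + 1) + b ^ q + b \<noteq> 0"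
    using l by (auto simp: l_eq secants_def unital_def)
  define \<kappa> where "\<kappa> = a ^ (q + 1) + b ^ q + b"
  define Z where "Z = {z :: F. z ^ (q + 1) = \<kappa>}"
  have \<kappa>: "\<kappa> \<in> sq_field q"
    unfolding \<kappa>_def using ab by (intro sq_field_closed) auto
  have \<kappa>q: "\<kappa> ^ q = \<kappa>"
    unfolding \<kappa>_def using ab c_c[of a] c_c[of b] by (simp add: add_power_q power_mult_distrib add_ac mult_ac)
  \<comment> \<open>The roots are taken in the closure. They lie in the field because
    \<open>\<kappa> ^ q = \<kappa>\<close>: equating \<open>z ^ q * z\<close> with its power
    \<open>q\<close> lets \<open>z ^ q\<close> cancel.\<close>
  have ZK: "z \<in> sq_field q" if "z \<in> Z" for z
  proof -
    have z: "z ^ q * z = \<kappa>" using that by (simp add: Z_def mult.commute)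
    then have "(z ^ q) ^ q * z ^ q = z * z ^ q"
      using \<kappa>q by (metis mult.commute power_mult_distrib)
    moreover have "z ^ q \<noteq> 0" using z ab by (auto simp: \<kappa>_def)
    ultimately have "(z ^ q) ^ q = z" by (metis mult_right_cancel)
    then show ?thesis by (simp add: sq_field_def power_mult)
  qed
  have "bij_betw (\<lambda>z. (z + a ^ q, a * (z + a ^ q) + b)) Z {p \<in> unital q. on_line p l}"
  proof (rule bij_betw_imageI)
    show "inj_on (\<lambda>z. (z + a ^ q, a * (z + a ^ q) + b)) Z" by (auto simp: inj_on_def)
    have key: "(a * x + b) ^ q + (a * x + b) = x ^ (q + 1) \<longleftrightarrow> x + a ^ q \<in> Z"
      if "x \<in> sq_field q" for x
    proof -
      have "(x + a ^ q) ^ (q + 1) = (x + a ^ q) * (x ^ q + a)"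
        using c_c[OF ab(2)] by (simp add: add_power_q)
      also have "\<dots> = x ^ (q + 1) + a * x + (a * x) ^ q + a ^ (q + 1)"
        by (simp add: algebra_simps power_mult_distrib)
      finally have e: "(x + a ^ q) ^ (q + 1) - \<kappa> = x ^ (q + 1) - ((a * x + b) ^ q + (a * x + b))"
        by (simp add: \<kappa>_def diff_F add_power_q add_ac add_self_F two_F)
      show ?thesis
        unfolding Z_def mem_Collect_eq using e by (metis right_minus_eq)
    qed
    show "(\<lambda>z. (z + a ^ q, a * (z + a ^ q) + b)) ` Z = {p \<in> unital q. on_line p l}"
    proof (intro equalityI subsetI)
      fix p assume "p \<in> (\<lambda>z. (z + a ^ q, a * (z + a ^ q) + b)) ` Z"
      then obtain z where z: "z \<in> Z" "p = (z + a ^ q, a * (z + a ^ q) + b)" by blast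
      have x: "z + a ^ q \<in> sq_field q"
        using ZK[OF z(1)] ab by (intro sq_field_closed) auto
      have "z + a ^ q + a ^ q = z" by (simp add: add.assoc add_self_F)
      then show "p \<in> {p \<in> unital q. on_line p l}"
        using key[OF x] z x ab sq_field_closed by (auto simp: unital_def on_line_def)
    next
      fix p assume p: "p \<in> {p \<in> unital q. on_line p l}"
      then have "fst p \<in> sq_field q" "snd p = a * fst p + b"
        "(snd p) ^ q + snd p = fst p ^ (q + 1)"
        using ab by (auto simp: unital_def on_line_def)
      then have "fst p + a ^ q \<in> Z" using key by metis
      moreover have "p = (fst p + a ^ q + a ^ q, a * (fst p + a ^ q + a ^ q) + b)"
        using p ab by (auto simp: on_line_def add.assoc add_self_F prod_eq_iff)
      ultimately show "p \<in> (\<lambda>z. (z + a ^ q, a * (z + a ^ q) + b)) ` Z" by blast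
    qed
  qed
  then have "card {p \<in> unital q. on_line p l} = card Z"
    by (simp add: bij_betw_same_card)
  also have "\<dots> = q + 1"
    unfolding Z_def by (rule card_roots_of_odd) (use even_q ab in \<open>auto simp: \<kappa>_def\<close>)
  finally show ?thesis .
qed

text \<open>Each of the four inequalities \<open>npl\<close> says that one of the four triples of
  lines is not concurrent.\<close>

lemma no_ONan_secants:
  assumes l: "l1 \<in> secants q" "l2 \<in> secants q" "l3 \<in> secants q" "l4 \<in> secants q"
    and neq: "distinct [l1, l2, l3, l4]"
    and p: "p12 \<in> unital q" "p13 \<in> unital q" "p14 \<in> unital q"
      "p23 \<in> unital q" "p24 \<in> unital q" "p34 \<in> unital q"
    and on: "on_line p12 l1" "on_line p12 l2" "on_line p13 l1" "on_line p13 l3"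
      "on_line p14 l1" "on_line p14 l4" "on_line p23 l2" "on_line p23 l3"
      "on_line p24 l2" "on_line p24 l4" "on_line p34 l3" "on_line p34 l4"
    and npl: "p12 \<noteq> p13" "p14 \<noteq> p13" "p34 \<noteq> p23" "p24 \<noteq> p12"
  shows False
proof -
  interpret frobenius_involution "\<lambda>x. x ^ q" "sq_field q" by (rule frobenius_involution)
  have mem: "fst p \<in> sq_field q" "snd p \<in> sq_field q" if "p \<in> unital q" for p
    using that by (auto simp: unital_def)
  have iso: "form (fst p, fst l * fst p + snd l) (fst p, fst l * fst p + snd l) = 0"
    if "p \<in> unital q" "on_line p l" for p l
  proof -
    have "snd p = fst l * fst p + snd l" "snd p ^ q + snd p = fst p ^ (q + 1)"
      using that by (auto simp: unital_def on_line_def)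
    then show ?thesis
      by (simp add: form_def add_eq_0_F add.commute two_F)
  qed
  have slope: "fst l \<noteq> fst l'" if "l \<noteq> l'" "on_line p l" "on_line p l'" for l l' p
    using that by (auto simp: on_line_def prod_eq_iff)
  have absc: "fst p \<noteq> fst p'" if "p \<noteq> p'" "on_line p l" "on_line p' l" for p p' l
    using that by (auto simp: on_line_def prod_eq_iff)
  have eq: "fst l * fst p + snd l = fst l' * fst p + snd l'" if "on_line p l" "on_line p l'" for p l l'
    using that by (simp add: on_line_def)
  have in_K: "fst l * fst p + snd l \<in> sq_field q" if "on_line p l" "p \<in> unital q" for p l
    using that mem by (metis on_line_def)
  have "\<not> on_line p23 l1"
  proof
    assume "on_line p23 l1"
    then have "p23 = p12" "p23 = p13"
      using two_lines_meet_once[of l1 l2 p23 p12] two_lines_meet_once[of l1 l3 p23 p13] neq on by auto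
    with npl show False by simp
  qed
  then have n: "fst l1 * fst p23 + snd l1 \<noteq> fst l2 * fst p23 + snd l2"
    using on by (simp add: on_line_def)
  have d: "l1 \<noteq> l4" "l2 \<noteq> l4" "l3 \<noteq> l4" using neq by auto
  show False
    by (rule no_ONan_configuration[of "fst p12" "fst p13" "fst p23" "fst p14" "fst p24" "fst p34"
        "fst l1" "snd l1" "fst l2" "snd l2" "fst l3" "snd l3" "fst l4" "snd l4"])
      (fact mem[OF p(1)] mem[OF p(2)] mem[OF p(3)] mem[OF p(4)] mem[OF p(5)] mem[OF p(6)] n
        in_K[OF on(1) p(1)] in_K[OF on(3) p(2)] in_K[OF on(7) p(4)]
        eq[OF on(1,2)] eq[OF on(3,4)] eq[OF on(7,8)] eq[OF on(5,6)] eq[OF on(9,10)] eq[OF on(11,12)]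
        iso[OF p(1) on(1)] iso[OF p(2) on(3)] iso[OF p(4) on(7)] iso[OF p(3) on(5)]
        iso[OF p(5) on(9)] iso[OF p(6) on(11)]
        slope[OF d(1) on(5,6)] slope[OF d(2) on(9,10)] slope[OF d(3) on(11,12)]
        absc[OF npl(2) on(5,3)] absc[OF npl(3) on(11,8)] absc[OF npl(4) on(9,2)]
        absc[OF npl(1) on(1,3)])+
qed

end

section \<open>The graph of secants\<close>

text \<open>The lines through a curve point \<open>p\<close> are joined only across the split into
  \<open>S p\<close> and the rest; two lines determine \<open>p\<close>.\<close>

definition secant_adj :: "nat \<Rightarrow> (F \<times> F \<Rightarrow> (F \<times> F) set) \<Rightarrow> F \<times> F \<Rightarrow> F \<times> F \<Rightarrow> bool" where
  "secant_adj q S l l' \<longleftrightarrow>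
    l \<noteq> l' \<and> (\<exists>p\<in>unital q. on_line p l \<and> on_line p l' \<and> (l \<in> S p \<longleftrightarrow> l' \<notin> S p))"

definition lines_through :: "nat \<Rightarrow> F \<times> F \<Rightarrow> (F \<times> F) set" where
  "lines_through q p = {l \<in> secants q. on_line p l}"

lemma secant_adj_sym: "secant_adj q S l l' \<Longrightarrow> secant_adj q S l' l"
  by (auto simp: secant_adj_def)

lemma secant_adj_irrefl: "\<not> secant_adj q S l l"
  by (simp add: secant_adj_def)

context
  fixes k q :: nat
  assumes k: "k > 0" and q: "q = 2 ^ k"
begin

text \<open>Three pairwise adjacent lines are not concurrent, as they would form a triangle in the
  bipartite graph at their common point. Four pairwise adjacent secants would therefore be an O'Nan
  configuration.\<close>

lemma secant_adj_K4_free: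
  assumes C: "C \<subseteq> secants q" "card C = 4"
  shows "\<exists>x\<in>C. \<exists>y\<in>C. x \<noteq> y \<and> \<not> secant_adj q S x y"
proof (rule ccontr)
  assume contra: "\<not> ?thesis"
  obtain l1 l2 l3 l4 where l: "C = {l1, l2, l3, l4}" "distinct [l1, l2, l3, l4]"
  proof -
    have "finite C" using C(2) by (simp add: card_ge_0_finite)
    then obtain xs where xs: "set xs = C" "distinct xs" "length xs = 4"
      using finite_distinct_list[of C] C(2) distinct_card by metis
    then obtain a b c d where "xs = [a, b, c, d]"
      by (auto simp: numeral_eq_Suc length_Suc_conv)
    with xs show ?thesis using that[of a b c d] by simp
  qed
  have meet: "\<exists>p\<in>unital q. on_line p l \<and> on_line p l' \<and> (l \<in> S p \<longleftrightarrow> l' \<notin> S p)"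
    if "l \<in> C" "l' \<in> C" "l \<noteq> l'" for l l'
    using contra that by (auto simp: secant_adj_def)
  \<comment> \<open>If \<open>p = p'\<close>, then \<open>b\<close> and \<open>c\<close> meet there
    too, so \<open>p'' = p\<close>, and three lines would lie on pairwise different sides of a split
    in two.\<close>
  have triple: "p \<noteq> p'"
    if "b \<noteq> c" "on_line p a" "on_line p b" "a \<in> S p \<longleftrightarrow> b \<notin> S p"
      "on_line p' a" "on_line p' c" "a \<in> S p' \<longleftrightarrow> c \<notin> S p'"
      "on_line p'' b" "on_line p'' c" "b \<in> S p'' \<longleftrightarrow> c \<notin> S p''" for a b c p p' p''
    using two_lines_meet_once[of b c p p''] that by auto
  obtain p12 where p12: "p12 \<in> unital q" "on_line p12 l1" "on_line p12 l2" "l1 \<in> S p12 \<longleftrightarrow> l2 \<notin> S p12"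
    using meet[of l1 l2] l by auto
  obtain p13 where p13: "p13 \<in> unital q" "on_line p13 l1" "on_line p13 l3" "l1 \<in> S p13 \<longleftrightarrow> l3 \<notin> S p13"
    using meet[of l1 l3] l by auto
  obtain p14 where p14: "p14 \<in> unital q" "on_line p14 l1" "on_line p14 l4" "l1 \<in> S p14 \<longleftrightarrow> l4 \<notin> S p14"
    using meet[of l1 l4] l by auto
  obtain p23 where p23: "p23 \<in> unital q" "on_line p23 l2" "on_line p23 l3" "l2 \<in> S p23 \<longleftrightarrow> l3 \<notin> S p23"
    using meet[of l2 l3] l by auto
  obtain p24 where p24: "p24 \<in> unital q" "on_line p24 l2" "on_line p24 l4" "l2 \<in> S p24 \<longleftrightarrow> l4 \<notin> S p24"
    using meet[of l2 l4] l by auto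
  obtain p34 where p34: "p34 \<in> unital q" "on_line p34 l3" "on_line p34 l4" "l3 \<in> S p34 \<longleftrightarrow> l4 \<notin> S p34"
    using meet[of l3 l4] l by auto
  have "p12 \<noteq> p13" by (rule triple[of l2 l3 p12 l1 p13 p23]) (use p12 p13 p23 l in auto)
  moreover have "p14 \<noteq> p13" by (rule triple[of l4 l3 p14 l1 p13 p34]) (use p14 p13 p34 l in auto)
  moreover have "p34 \<noteq> p23" by (rule triple[of l4 l2 p34 l3 p23 p24]) (use p34 p23 p24 l in auto)
  moreover have "p24 \<noteq> p12" by (rule triple[of l4 l1 p24 l2 p12 p14]) (use p24 p12 p14 l in auto)
  ultimately show False
    using no_ONan_secants[OF k q, of l1 l2 l3 l4 p12 p13 p14 p23 p24 p34]
      C(1) l p12 p13 p14 p23 p24 p34 by auto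
qed

text \<open>Two lines meet only once, so a pair is counted at one curve point only and the edge
  counts at the points add up.\<close>

lemma secant_adj_pairs:
  assumes Y: "Y \<subseteq> secants q"
  shows "(\<Sum>p\<in>unital q. card (S p \<inter> (Y \<inter> lines_through q p)) * card ((Y \<inter> lines_through q p) - S p)) \<le>
    (\<Sum>l\<in>Y. card {l' \<in> Y. secant_adj q S l l'})"
proof -
  have finX: "finite Y" using Y finite_secants[OF k q] finite_subset by blast
  define E where "E p = (S p \<inter> (Y \<inter> lines_through q p)) \<times> ((Y \<inter> lines_through q p) - S p)" for p
  have disj: "E p \<inter> E p' = {}" if "p \<noteq> p'" for p p'
  proof (rule ccontr)
    assume "E p \<inter> E p' \<noteq> {}"
    then obtain l l' where "(l, l') \<in> E p" "(l, l') \<in> E p'" by auto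
    then have "l \<noteq> l'" "on_line p l" "on_line p l'" "on_line p' l" "on_line p' l'"
      by (auto simp: E_def lines_through_def)
    then have "p = p'" by (rule two_lines_meet_once)
    with that show False ..
  qed
  have "(\<Sum>p\<in>unital q. card (E p)) = card (\<Union>p\<in>unital q. E p)"
    by (rule card_UN_disjoint[symmetric])
      (use finite_unital[OF k q] finX disj in \<open>auto simp: E_def\<close>)
  also have "\<dots> \<le> card (Sigma Y (\<lambda>l. {l' \<in> Y. secant_adj q S l l'}))"
    by (rule card_mono) (use finX in \<open>auto simp: E_def lines_through_def secant_adj_def\<close>)
  also have "\<dots> = (\<Sum>l\<in>Y. card {l' \<in> Y. secant_adj q S l l'})"
    using finX by simp
  finally show ?thesis by (simp add: E_def card_cartesian_product)
qed

text \<open>Some vertex of \<open>Y\<close> has at least average degree, and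
  \<open>bipartite_edges_ge\<close> bounds the average below: each secant has
  \<open>s = q + 1\<close> of the at most \<open>q ^ 3\<close> points.\<close>

lemma ex_secant_bipartition:
  assumes large: "64 * k + 32 \<le> q"
  shows "\<exists>S. \<forall>Y\<subseteq>secants q. 32 * q\<^sup>2 \<le> card Y \<longrightarrow>
    (\<exists>l\<in>Y. 1 / (128 * q) * card Y \<le> card {l' \<in> Y. secant_adj q S l l'})"
proof -
  have fin: "finite (unital q)" "finite (secants q)"
    using finite_unital[OF k q] finite_secants[OF k q] by auto
  have q0: "q > 0" using q by simp
  have cP: "card (unital q) \<le> q ^ 3" by (rule card_unital_le[OF k q])
  have bound: "32 * card (unital q) \<le> (q + 1) * m" if "32 * q\<^sup>2 \<le> m" for m
  proof -
    have "32 * card (unital q) \<le> q * (32 * q\<^sup>2)"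
      using cP by (simp add: power2_eq_square power3_eq_cube)
    also have "\<dots> \<le> (q + 1) * m"
      by (rule mult_le_mono) (use that in auto)
    finally show ?thesis .
  qed
  \<comment> \<open>As \<open>q ^ 4 = 2 ^ (4 * k)\<close>, it suffices that
    \<open>4 * k - (q + 1) / 16 \<le> - 2\<close>, which is \<open>large\<close>.\<close>
  have "card (secants q) * 2 powr (- (real (q + 1) / 16)) \<le> 1 / 4"
  proof -
    have "real (card (secants q)) \<le> real (q ^ 4)"
      using card_secants(2)[OF k q] by (simp only: of_nat_le_iff)
    also have "\<dots> = 2 powr (4 * k)"
      by (simp add: q powr_realpow[symmetric] powr_powr mult.commute flip: power_mult)
    finally have "card (secants q) * 2 powr (- (real (q + 1) / 16)) \<le>
        2 powr (4 * k) * 2 powr (- (real (q + 1) / 16))"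
      by (rule mult_right_mono) simp
    also have "\<dots> = 2 powr (4 * k + - (real (q + 1) / 16))"
      by (rule powr_add[symmetric])
    also have "\<dots> \<le> 2 powr (- 2)"
    proof (rule powr_mono)
      have "real (64 * k + 32) \<le> real q" using large by (simp only: of_nat_le_iff)
      then show "real (4 * k) + - (real (q + 1) / 16) \<le> - 2" by (simp add: field_simps)
    qed simp
    also have "\<dots> = 1 / 4" by (simp add: powr_minus)
    finally show ?thesis .
  qed
  then obtain S where S: "\<And>Y. Y \<subseteq> secants q \<Longrightarrow> 32 * q\<^sup>2 \<le> card Y \<Longrightarrow>
      4 * (\<Sum>p | p \<in> unital q \<and> 8 \<le> card (Y \<inter> lines_through q p) \<and>
        unbalanced (Y \<inter> lines_through q p) (S p). card (Y \<inter> lines_through q p)) < (q + 1) * card Y"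
    using ex_mostly_balanced[OF fin, of "lines_through q" "32 * q\<^sup>2" "q + 1"] bound[OF order_refl] q0
    by (auto simp: lines_through_def)
  show ?thesis
  proof (intro exI allI impI)
    fix Y assume Y: "Y \<subseteq> secants q" and m: "32 * q\<^sup>2 \<le> card Y"
    have finX: "finite Y" using Y fin finite_subset by blast
    have m0: "card Y > 0" using m q0 by (cases "card Y") auto
    have pts: "card {p \<in> unital q. l \<in> lines_through q p} = q + 1" if "l \<in> Y" for l
    proof -
      have "{p \<in> unital q. l \<in> lines_through q p} = {p \<in> unital q. on_line p l}"
        using that Y by (auto simp: lines_through_def)
      then show ?thesis using card_points_on_secant[OF k q, of l] that Y by auto
    qed
    let ?e = "\<Sum>l\<in>Y. card {l' \<in> Y. secant_adj q S l l'}"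
    have "((q + 1) * card Y)\<^sup>2 \<le> 128 * card (unital q) *
        (\<Sum>p\<in>unital q. card (S p \<inter> (Y \<inter> lines_through q p)) * card ((Y \<inter> lines_through q p) - S p))"
      by (rule bipartite_edges_ge[OF fin(1) finX pts bound[OF m] S[OF Y m]])
    also have "\<dots> \<le> 128 * q ^ 3 * ?e"
      by (intro mult_le_mono secant_adj_pairs Y cP order_refl)
    finally have edges: "((q + 1) * card Y)\<^sup>2 \<le> 128 * q ^ 3 * ?e" .
    \<comment> \<open>Weak inequalities suffice for the contradiction, since \<open>edges\<close>
      has \<open>q + 1\<close> where small degrees would give \<open>q\<close>.\<close>
    show "\<exists>l\<in>Y. 1 / (128 * q) * card Y \<le> card {l' \<in> Y. secant_adj q S l l'}"
    proof (rule ccontr)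
      assume "\<not> ?thesis"
      then have "real (card {l' \<in> Y. secant_adj q S l l'}) \<le> 1 / (128 * q) * card Y" if "l \<in> Y" for l
        using that by force
      then have "(\<Sum>l\<in>Y. real (card {l' \<in> Y. secant_adj q S l l'})) \<le> (\<Sum>l\<in>Y. 1 / (128 * q) * card Y)"
        by (rule sum_mono)
      then have "real ?e \<le> (real (card Y))\<^sup>2 / (128 * q)"
        by (simp add: power2_eq_square)
      then have "128 * real q ^ 3 * ?e \<le> 128 * real q ^ 3 * ((real (card Y))\<^sup>2 / (128 * q))"
        by (rule mult_left_mono) simp
      also have "\<dots> = (real q * card Y)\<^sup>2"
        using q0 by (simp add: power2_eq_square power3_eq_cube)
      finally have "128 * real q ^ 3 * ?e \<le> (real q * card Y)\<^sup>2" .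
      moreover have "real (((q + 1) * card Y)\<^sup>2) \<le> real (128 * q ^ 3 * ?e)"
        using edges by (simp only: of_nat_le_iff)
      moreover have "real (128 * q ^ 3 * ?e) = 128 * real q ^ 3 * ?e" "real ((q * card Y)\<^sup>2) = (real q * card Y)\<^sup>2"
        by simp_all
      ultimately have "real (((q + 1) * card Y)\<^sup>2) \<le> real ((q * card Y)\<^sup>2)"
        by linarith
      then have "((q + 1) * card Y)\<^sup>2 \<le> (q * card Y)\<^sup>2"
        by (simp only: of_nat_le_iff)
      then have "(q + 1) * card Y \<le> q * card Y"
        by (rule power2_le_imp_le) simp
      with m0 show False by simp
    qed
  qed
qed

end

section \<open>Choice of parameters and passage to all \<open>t\<close>\<close>

text \<open>The source of the threshold 14, as the inequality fails at 13. It makes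
  \<open>x \<le> 1\<close> and \<open>c > 0\<close> below.\<close>

lemma sq_le_two_power:
  assumes "k \<ge> 14"
  shows "64 * k\<^sup>2 \<le> 2 ^ k"
  using assms
proof (induction k rule: dec_induct)
  case (step n)
  have "64 * (Suc n)\<^sup>2 \<le> 2 * (64 * n\<^sup>2)"
  proof -
    have "2 * n + 1 \<le> 14 * n" using step by simp
    also have "\<dots> \<le> n * n" using step by simp
    finally show ?thesis by (simp add: power2_eq_square)
  qed
  then show ?case using step by simp
qed simp

text \<open>The container bound leaves at most \<open>(6 / x) ^ \<tau>\<close> independent sets of
  size \<open>\<tau>\<close>. As \<open>12 \<le> x * c\<close>, one of \<open>c\<close> random
  colour classes avoids them all and has at least \<open>card N / c\<close> secants.\<close>

lemma ramsey_number_4_ge: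
  assumes k: "k \<ge> 14" and t: "2048 * 2 ^ k * k\<^sup>2 \<le> t"
  shows "(2 ^ k) ^ 3 * k\<^sup>2 \<le> ramsey_number 4 t"
proof -
  define q :: nat where "q = 2 ^ k"
  \<comment> \<open>\<open>x\<close> is chosen so that \<open>R * x = \<tau>\<close>, and
    \<open>r\<close> so that
    \<open>(1 - 1 / (128 * q)) ^ r \<le> exp (- 2 * k) \<le> 1 / q^2\<close>, which takes
    \<open>q ^ 4\<close> candidates below \<open>R\<close>.\<close>
  define \<tau> where "\<tau> = 2048 * q * k\<^sup>2"
  define R where "R = 32 * q\<^sup>2"
  define r where "r = 256 * q * k"
  define x where "x = 64 * real (k\<^sup>2) / q"
  define N where "N = secants q"
  define c where "c = q div (4 * k\<^sup>2)"
  have k0: "k > 0" using k by simp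
  have kq: "64 * k\<^sup>2 \<le> q" using sq_le_two_power[OF k] by (simp add: q_def)
  have k2: "k \<le> k\<^sup>2" "1 \<le> k\<^sup>2" using k0 by (auto simp: power2_eq_square)
  have q0: "q > 0" by (simp add: q_def)
  have "64 * k + 32 \<le> q"
  proof -
    have "14 * k \<le> k * k" using k by simp
    then show ?thesis using kq k unfolding power2_eq_square by linarith
  qed
  then obtain S where S: "\<And>Y. Y \<subseteq> N \<Longrightarrow> R \<le> card Y \<Longrightarrow>
      \<exists>l\<in>Y. 1 / (128 * q) * card Y \<le> card {l' \<in> Y. secant_adj q S l l'}"
    using ex_secant_bipartition[OF k0 q_def] unfolding N_def R_def by blast
  let ?adj = "secant_adj q S"
  have finN: "finite N" unfolding N_def by (rule finite_secants[OF k0 q_def])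
  have cN: "q ^ 4 - q ^ 3 \<le> card N" "card N \<le> q ^ 4"
    unfolding N_def by (rule card_secants[OF k0 q_def])+
  have cN': "real (card N) \<le> real q ^ 4" using cN(2) by (metis of_nat_le_iff of_nat_power)
  have x: "0 < x" "x \<le> 1"
  proof -
    show "0 < x" using k0 q0 by (simp add: x_def)
    have "real (64 * k\<^sup>2) \<le> real q" using kq by (simp only: of_nat_le_iff)
    then show "x \<le> 1" using q0 by (simp add: x_def)
  qed
  have Z: "indep_poly ?adj N x \<le> (1 + x) ^ R * (1 + x * card N) ^ r"
  proof (rule indep_poly_container[where \<alpha> = "1 / (128 * q)" and V = N])
    show "1 / real (128 * q) \<le> 1" using q0 by simp
    have "(1 - 1 / real (128 * q)) ^ r \<le> exp (- (1 / real (128 * q))) ^ r"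
      using exp_ge_add_one_self[of "- (1 / real (128 * q))"] q0 by (intro power_mono) auto
    also have "\<dots> = exp (real r * - (1 / real (128 * q)))"
      by (rule exp_of_nat_mult[symmetric])
    also have "real r * - (1 / real (128 * q)) = real (2 * k) * (- 1)"
      using q0 by (simp add: r_def)
    also have "exp (real (2 * k) * (- 1)) = exp (- 1) ^ (2 * k)"
      by (rule exp_of_nat_mult)
    also have "\<dots> \<le> (1 / 2) ^ (2 * k)"
      using exp_ge_add_one_self[of 1] by (intro power_mono) (auto simp: exp_minus field_simps)
    also have "\<dots> = 1 / real q ^ 2"
      by (simp add: q_def power_divide flip: power_mult)
    finally have "(1 - 1 / real (128 * q)) ^ r * card N \<le> 1 / real q ^ 2 * real q ^ 4"
      using cN' by (intro mult_mono) auto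
    also have "\<dots> = real q ^ 2"
      using q0 by (simp add: power2_eq_square power4_eq_xxxx)
    also have "\<dots> \<le> R" by (simp add: R_def)
    finally show "(1 - 1 / real (128 * q)) ^ r * card N \<le> R" .
  qed (use finN S x secant_adj_irrefl in auto)
  have Z1: "(1 + x) ^ R \<le> 3 ^ \<tau>"
  proof -
    have "(1 + x) ^ R \<le> exp x ^ R"
      using x by (intro power_mono exp_ge_add_one_self) auto
    also have "\<dots> = exp (real R * x)" by (rule exp_of_nat_mult[symmetric])
    also have "real R * x = real \<tau> * 1"
      using q0 by (simp add: R_def x_def \<tau>_def power2_eq_square)
    also have "exp (real \<tau> * 1) = exp 1 ^ \<tau>" by (rule exp_of_nat_mult)
    also have "\<dots> \<le> 3 ^ \<tau>" by (intro power_mono exp_le) simp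
    finally show ?thesis .
  qed
  \<comment> \<open>The base is at most \<open>q ^ 5 = 2 ^ (5 * k)\<close>, and
    \<open>5 * k * r = 1280 * q * k^2\<close> is below \<open>\<tau>\<close>.\<close>
  have Z2: "(1 + x * card N) ^ r \<le> 2 ^ \<tau>"
  proof -
    have "1 + x * card N \<le> 1 + 1 * real q ^ 4"
      using x cN' by (intro add_left_mono mult_mono) auto
    also have "\<dots> \<le> 2 * real q ^ 4" using q0 by (simp add: Suc_leI)
    also have "\<dots> \<le> real q * real q ^ 4"
      by (rule mult_right_mono) (use k0 self_le_power[of "2::real" k] in \<open>auto simp: q_def\<close>)
    also have "\<dots> = (2 ^ k) ^ 5"
      by (simp add: q_def eval_nat_numeral)
    also have "\<dots> = 2 ^ (k * 5)" by (rule power_mult[symmetric])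
    finally have "(1 + x * card N) ^ r \<le> (2 ^ (k * 5)) ^ r"
      by (rule power_mono) (use x in auto)
    also have "\<dots> = 2 ^ (k * 5 * r)" by (rule power_mult[symmetric])
    also have "\<dots> \<le> 2 ^ \<tau>"
      by (rule power_increasing) (auto simp: r_def \<tau>_def power2_eq_square)
    finally show ?thesis .
  qed
  define T where "T = {I \<in> indep_sets ?adj N. card I = \<tau>}"
  have "card T * x ^ \<tau> \<le> indep_poly ?adj N x"
    unfolding T_def by (rule card_indep_sets_le[OF finN x(1)])
  also have "\<dots> \<le> 3 ^ \<tau> * 2 ^ \<tau>"
    by (rule order_trans[OF Z mult_mono[OF Z1 Z2]]) (use x in auto)
  also have "\<dots> = 6 ^ \<tau>" by (simp flip: power_mult_distrib)
  finally have cT: "card T * x ^ \<tau> \<le> 6 ^ \<tau>" .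
  have ck: "c * (4 * k\<^sup>2) \<le> q" by (simp add: c_def)
  \<comment> \<open>Rounding in \<open>c\<close> loses less than \<open>4 * k^2\<close>, at most a
    sixteenth of \<open>q\<close>.\<close>
  have c_lower: "3 * q \<le> 16 * k\<^sup>2 * c"
  proof -
    have "q = c * (4 * k\<^sup>2) + q mod (4 * k\<^sup>2)"
      unfolding c_def by (rule div_mult_mod_eq[symmetric])
    moreover have "q mod (4 * k\<^sup>2) < 4 * k\<^sup>2" using k0 by simp
    ultimately have "q < c * (4 * k\<^sup>2) + 4 * k\<^sup>2" by linarith
    then show ?thesis using kq by (simp add: algebra_simps)
  qed
  have c0: "c > 0" using c_lower q0 by (cases c) auto
  \<comment> \<open>Of \<open>12 = 6 * 2\<close>, the 6 beats the count of independent sets and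
    \<open>2 ^ \<tau>\<close> absorbs the extra factor \<open>c\<close>.\<close>
  have "12 \<le> x * c"
  proof -
    have "real (3 * q) \<le> real (16 * k\<^sup>2 * c)" using c_lower by (simp only: of_nat_le_iff)
    then show ?thesis using q0 by (simp add: x_def field_simps)
  qed
  then have "12 ^ \<tau> \<le> x ^ \<tau> * real c ^ \<tau>"
    unfolding power_mult_distrib[symmetric] by (rule power_mono) simp
  have "card T * c < c ^ \<tau>"
  proof -
    have "c \<le> q" using ck k2 by (metis dual_order.trans le_add1 mult.right_neutral mult_le_mono2 c_def div_le_dividend)
    also have "q < 2 ^ \<tau>"
    proof -
      have "q \<le> \<tau>" using k2 by (simp add: \<tau>_def)
      then show ?thesis using less_exp[of \<tau>] by linarith
    qed
    finally have "real c < 2 ^ \<tau>" by (metis of_nat_less_iff of_nat_numeral of_nat_power)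
    then have "6 ^ \<tau> * real c < 6 ^ \<tau> * 2 ^ \<tau>" by simp
    also have "\<dots> = 12 ^ \<tau>" by (simp flip: power_mult_distrib)
    also have "\<dots> \<le> x ^ \<tau> * real c ^ \<tau>" by fact
    finally have "6 ^ \<tau> * real c < x ^ \<tau> * real c ^ \<tau>" .
    moreover have "card T * x ^ \<tau> * real c \<le> 6 ^ \<tau> * real c"
      using cT by (rule mult_right_mono) simp
    ultimately have "x ^ \<tau> * (card T * real c) < x ^ \<tau> * real c ^ \<tau>"
      by (simp add: mult_ac)
    then have "card T * real c < real c ^ \<tau>" using x by simp
    then show ?thesis by (metis of_nat_less_iff of_nat_mult of_nat_power)
  qed
  then obtain W where W: "W \<subseteq> N" "card N \<le> card W * c" "\<And>I. I \<in> T \<Longrightarrow> \<not> I \<subseteq> W"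
    using ex_large_subset_avoiding[OF finN, of T \<tau> c] c0
    by (auto simp: T_def indep_sets_def)
  have "card W < ramsey_number 4 t"
  proof (rule ramsey_number_gt[where adj = ?adj])
    show "finite W" using W finN finite_subset by blast
    show "\<exists>x\<in>C. \<exists>y\<in>C. x \<noteq> y \<and> \<not> ?adj x y" if "C \<subseteq> W" "card C = 4" for C
      using secant_adj_K4_free[OF k0 q_def] that W by (auto simp: N_def)
    show "\<exists>x\<in>I. \<exists>y\<in>I. x \<noteq> y \<and> ?adj x y" if I: "I \<subseteq> W" "card I = t" for I
    proof (rule ccontr)
      assume contra: "\<not> ?thesis"
      have "\<tau> \<le> card I" using t I by (simp add: \<tau>_def q_def)
      then obtain J where J: "J \<subseteq> I" "card J = \<tau>"
        by (rule obtain_subset_with_card_n)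
      have "\<not> ?adj x y" if "x \<in> J" "y \<in> J" for x y
        using contra J(1) that secant_adj_irrefl by (cases "x = y") blast+
      moreover have "J \<subseteq> N" using J(1) I(1) W(1) by (rule subset_trans[OF subset_trans])
      ultimately have "J \<in> T"
        using J(2) unfolding T_def indep_sets_def by blast
      with W J I show False by blast
    qed
  qed (auto simp: secant_adj_irrefl intro: secant_adj_sym)
  \<comment> \<open>\<open>card N\<close> is at least \<open>q ^ 4 / 2\<close>, and \<open>c\<close>
    is at most \<open>q / (4 * k^2)\<close>.\<close>
  moreover have "q ^ 3 * k\<^sup>2 \<le> card W"
  proof -
    have "2 * q ^ 3 \<le> q * q ^ 3"
      using k0 self_le_power[of "2::nat" k] by (intro mult_le_mono1) (simp add: q_def)
    also have "q * q ^ 3 = q ^ 4" by (simp add: eval_nat_numeral)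
    finally have "q ^ 4 \<le> 2 * card N"
      using cN(1) by linarith
    also have "\<dots> \<le> 2 * (card W * c)" using W by simp
    finally have "q ^ 4 * (4 * k\<^sup>2) \<le> 2 * (card W * c) * (4 * k\<^sup>2)"
      by (rule mult_le_mono1)
    also have "\<dots> = 2 * card W * (c * (4 * k\<^sup>2))" by simp
    also have "\<dots> \<le> 2 * card W * q" using ck by (rule mult_le_mono2)
    finally have "q * (2 * (q ^ 3 * k\<^sup>2)) \<le> q * card W"
      by (simp add: power4_eq_xxxx power3_eq_cube mult_ac)
    then show ?thesis using q0 by simp
  qed
  ultimately show ?thesis by (simp add: q_def)
qed

text \<open>Interpolates between the sizes reached by consecutive powers of two, at the cost of a
  constant factor.\<close>

lemma ex_scale:
  assumes "2048 * 2 ^ 14 * 14\<^sup>2 \<le> (t :: nat)"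
  obtains k where "k \<ge> 14" "2048 * 2 ^ k * k\<^sup>2 \<le> t" "t < 2048 * 2 ^ Suc k * (Suc k)\<^sup>2"
proof -
  define f :: "nat \<Rightarrow> nat" where "f k = 2048 * 2 ^ k * k\<^sup>2" for k
  define m where "m = (LEAST m. t < f m)"
  \<comment> \<open>Guarantees that the \<open>LEAST\<close> is attained.\<close>
  have "t < f (Suc t)"
  proof -
    have "t < 2 ^ Suc t" using less_exp[of "Suc t"] by linarith
    also have "\<dots> \<le> f (Suc t)" by (simp add: f_def)
    finally show ?thesis .
  qed
  then have m: "t < f m" unfolding m_def by (rule LeastI)
  have "m > 14"
  proof (rule ccontr)
    assume "\<not> m > 14"
    then have "f m \<le> f 14" unfolding f_def by (intro mult_le_mono power_mono power_increasing) auto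
    moreover have "f 14 \<le> t" using assms by (simp add: f_def)
    ultimately show False using m by linarith
  qed
  then obtain k where k: "m = Suc k" by (cases m) auto
  moreover have "\<not> t < f k" using not_less_Least[of k "\<lambda>m. t < f m"] k by (simp add: m_def)
  ultimately show ?thesis using that[of k] m \<open>m > 14\<close> by (simp add: f_def)
qed

theorem theorem1:
  shows "\<exists>c::real. c > 0 \<and> (\<forall>\<^sub>F t in sequentially.
           real (ramsey_number 4 t) \<ge> c * real t ^ 3 / (ln (real t)) ^ 4)"
proof (intro exI conjI)
  \<comment> \<open>From \<open>Suc k \<le> 2 * k\<close> follows
    \<open>t \<le> 2 ^ 14 * 2 ^ k * k^2\<close>, whose cube contributes \<open>2 ^ 42\<close>;
    \<open>ln t \<ge> k / 2\<close> contributes the remaining \<open>2 ^ 4\<close>.\<close>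
  show "(1 / 2 ^ 46 :: real) > 0" by simp
  show "\<forall>\<^sub>F t in sequentially.
      real (ramsey_number 4 t) \<ge> 1 / 2 ^ 46 * real t ^ 3 / (ln (real t)) ^ 4"
  proof (rule eventually_sequentiallyI)
    fix t :: nat assume "2048 * 2 ^ 14 * 14\<^sup>2 \<le> t"
    then obtain k where k: "k \<ge> 14" "2048 * 2 ^ k * k\<^sup>2 \<le> t" "t < 2048 * 2 ^ Suc k * (Suc k)\<^sup>2"
      by (rule ex_scale)
    have "(2::nat) ^ k \<le> t"
    proof -
      have "(2::nat) ^ k * 1 \<le> 2 ^ k * (2048 * k\<^sup>2)" using k(1) by (intro mult_le_mono2) (simp add: Suc_leI)
      also have "\<dots> = 2048 * 2 ^ k * k\<^sup>2" by simp
      also have "\<dots> \<le> t" by (rule k(2))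
      finally show ?thesis by simp
    qed
    then have "(2::real) ^ k \<le> real t" by (metis of_nat_le_iff of_nat_numeral of_nat_power)
    then have "ln ((2::real) ^ k) \<le> ln (real t)" by (intro ln_mono) auto
    then have "real k * ln 2 \<le> ln (real t)" by (simp add: ln_realpow)
    moreover have "real k * (1 / 2) \<le> real k * ln 2"
      using ln2_ge_two_thirds by (intro mult_left_mono) auto
    ultimately have ln_t: "real k / 2 \<le> ln (real t)" by simp
    have "Suc k \<le> 2 * k" using k(1) by simp
    then have "(Suc k)\<^sup>2 \<le> (2 * k)\<^sup>2" by (rule power_mono) simp
    then have "2048 * 2 ^ Suc k * (Suc k)\<^sup>2 \<le> 2048 * 2 ^ Suc k * (2 * k)\<^sup>2" by (rule mult_le_mono2)
    also have "\<dots> = 2 ^ 14 * 2 ^ k * k\<^sup>2" by (simp add: power_mult_distrib)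
    finally have "t \<le> 2 ^ 14 * 2 ^ k * k\<^sup>2" using k(3) by linarith
    then have "real t \<le> real (2 ^ 14 * 2 ^ k * k\<^sup>2)" by (simp only: of_nat_le_iff)
    then have "real t ^ 3 \<le> (2 ^ 14 * 2 ^ k * (real k)\<^sup>2) ^ 3" by (intro power_mono) auto
    moreover have "(real k / 2) ^ 4 \<le> ln (real t) ^ 4" using ln_t by (rule power_mono) simp
    moreover have "(real k / 2) ^ 4 > 0" using k(1) by simp
    ultimately have "1 / 2 ^ 46 * real t ^ 3 / ln (real t) ^ 4 \<le>
        1 / 2 ^ 46 * (2 ^ 14 * 2 ^ k * (real k)\<^sup>2) ^ 3 / (real k / 2) ^ 4"
      by (intro frac_le mult_left_mono) auto
    also have "\<dots> = (2 ^ k) ^ 3 * (real k)\<^sup>2"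
    proof -
      have "(2 ^ 14 * Q * K\<^sup>2) ^ 3 = 2 ^ 46 * (Q ^ 3 * K\<^sup>2) * (K / 2) ^ 4" for Q K :: real
        by (simp add: power2_eq_square power3_eq_cube power4_eq_xxxx)
      then show ?thesis using k(1) by simp
    qed
    also have "\<dots> = real ((2 ^ k) ^ 3 * k\<^sup>2)" by simp
    also have "\<dots> \<le> real (ramsey_number 4 t)"
      using ramsey_number_4_ge[OF k(1,2)] by (simp only: of_nat_le_iff)
    finally show "real (ramsey_number 4 t) \<ge> 1 / 2 ^ 46 * real t ^ 3 / (ln (real t)) ^ 4" .
  qed
qed

end
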